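(* Let $F, G\in \mathbb{C}(x)$ be such that $(F,G)$ satisfies Condition M for $c_1,\dots,c_k$, and let $p=\deg(F)$, $q=\deg(G)$. Assume that there exist two functions $f, g\in\mathcal{A}(\mathbb{C})$ such that $F(f)=G(g)$. Then $kq\leq p$.
   Context: $\mathcal{A}(\mathbb{C})$ denotes the algebra of entire functions in $\mathbb{C}$. For $F=\frac{A}{B}\in\mathbb{C}(x)$ with $A,B\in\mathbb{C}[x]$ and $\gcd(A,B)=1$, put $\deg(F)=\max(\deg(A),\deg(B))$. Condition M. Let $\mathbb{E}$ be an algebraically closed field, and let $F=\frac{A}{B}$, $G=\frac{C}{D}\in\mathbb{E}(x)$ with $A,B,C,D\in\mathbb{E}[x]$ and $\gcd(A,B)=\gcd(C,D)=1$. Let $c_1,\dots,c_k\in\mathbb{E}$ be zeros of the derivative $F'$. Then $(F,G)$ is said to satisfy Condition M for $c_1,\dots,c_k$ if: 1) $C$ and $D$ are monic; 2) $F(c_j)\neq F(c_l)$ for all $j\neq l$; 3) if $\deg(C)=\deg(D)$, then $F(c_j)\neq 1$ for all $j=1,\dots,k$; 4) for every $j=1,\dots,k$, we have $G(d)\neq F(c_j)$ and $D(d)\neq 0$ for every zero $d$ of $C'-F(c_j)D'$. Here $\mathbb{E}=\mathbb{C}$.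
   Formalization: The claim is proved for g nonconstant and with Condition M extended by: if deg(C)<deg(D), then F(c_j)≠0 for all j. Without either it is false, e.g. F=x^2, G=x^3+1, f=1, g=0; or F=(x^2-x^3)/(1+x^3), G=(x^2-1)/(x^6+1), f=e^{-2z}, g=e^z, with c_1=0. *)

theory Defs
  imports
    "HOL-Complex_Analysis.Complex_Analysis"
    "HOL-Computational_Algebra.Computational_Algebra"
    "HOL-Computational_Algebra.Field_as_Ring"
begin

type_synonym ratfun = "complex poly fract"

(* quot_of_fract yields the representation A / B with A, B coprime and B monic; all other
   coprime representations arise from it by a common nonzero constant factor. In particular F
   has a coprime representation with both A and B monic iff this one has a monic numerator. *)
definition rf_num :: "ratfun \<Rightarrow> complex poly" where
  "rf_num F = fst (quot_of_fract F)"

definition rf_den :: "ratfun \<Rightarrow> complex poly" where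
  "rf_den F = snd (quot_of_fract F)"

definition rf_degree :: "ratfun \<Rightarrow> nat" where
  "rf_degree F = max (degree (rf_num F)) (degree (rf_den F))"

definition rf_pole :: "ratfun \<Rightarrow> complex \<Rightarrow> bool" where
  "rf_pole F z \<longleftrightarrow> poly (rf_den F) z = 0"

(* By coprimality the denominator does not vanish at a zero of the numerator. *)
definition rf_zero :: "ratfun \<Rightarrow> complex \<Rightarrow> bool" where
  "rf_zero F z \<longleftrightarrow> poly (rf_num F) z = 0"

(* Only meaningful where F has no pole. *)
definition rf_eval :: "ratfun \<Rightarrow> complex \<Rightarrow> complex" where
  "rf_eval F z = poly (rf_num F) z / poly (rf_den F) z"

definition rf_deriv :: "ratfun \<Rightarrow> ratfun" where
  "rf_deriv F =
     Fract (pderiv (rf_num F) * rf_den F - rf_num F * pderiv (rf_den F)) (rf_den F ^ 2)"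

(* A zero of F' is never a pole of F (a pole of F is a pole of F'), so F (c j) is a genuine
   value below. If pderiv C - F (c j) * pderiv D is the zero polynomial, every d is a zero. *)
definition condition_M :: "ratfun \<Rightarrow> ratfun \<Rightarrow> nat \<Rightarrow> (nat \<Rightarrow> complex) \<Rightarrow> bool" where
  "condition_M F G k c \<longleftrightarrow>
     (let C = rf_num G; D = rf_den G in
       (\<forall>j\<in>{1..k}. rf_zero (rf_deriv F) (c j)) \<and>
       (lead_coeff C = 1 \<and> lead_coeff D = 1) \<and>
       (\<forall>j\<in>{1..k}. \<forall>l\<in>{1..k}. j \<noteq> l \<longrightarrow> rf_eval F (c j) \<noteq> rf_eval F (c l)) \<and>
       (degree C = degree D \<longrightarrow> (\<forall>j\<in>{1..k}. rf_eval F (c j) \<noteq> 1)) \<and>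
       (\<forall>j\<in>{1..k}. \<forall>d. poly (pderiv C - smult (rf_eval F (c j)) (pderiv D)) d = 0 \<longrightarrow>
          rf_eval G d \<noteq> rf_eval F (c j) \<and> poly D d \<noteq> 0))"

(* F(f) = G(g) as meromorphic functions, for entire f and g: neither composition is identically
   infinite, and the two sides agree wherever both are finite, i.e. off a discrete set. *)
definition rf_comp_eq ::
  "ratfun \<Rightarrow> (complex \<Rightarrow> complex) \<Rightarrow> ratfun \<Rightarrow> (complex \<Rightarrow> complex) \<Rightarrow> bool" where
  "rf_comp_eq F f G g \<longleftrightarrow>
     (\<exists>z. \<not> rf_pole F (f z)) \<and> (\<exists>z. \<not> rf_pole G (g z)) \<and>
     (\<forall>z. \<not> rf_pole F (f z) \<longrightarrow> \<not> rf_pole G (g z) \<longrightarrow> rf_eval F (f z) = rf_eval G (g z))"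


lemma quot_of_fract_Fract_monic:
  fixes A B :: "complex poly"
  assumes "coprime A B" and "lead_coeff B = 1"
  shows "rf_num (Fract A B) = A" and "rf_den (Fract A B) = B"
proof -
  have "unit_factor B = 1"
    using assms(2) by (simp add: unit_factor_poly_def)
  then have "(A, B) \<in> normalized_fracts"
    using assms(1) by (simp add: normalized_fracts_def)
  moreover have "quot_to_fract (A, B) = Fract A B"
    by (simp add: quot_to_fract_def)
  ultimately have "quot_of_fract (Fract A B) = (A, B)"
    by (metis quot_of_fract_quot_to_fract normalize_quot_id)
  then show "rf_num (Fract A B) = A" "rf_den (Fract A B) = B"
    by (simp_all add: rf_num_def rf_den_def)
qed

lemma rf_zero_Fract:
  assumes "poly N z = 0" and "poly M z \<noteq> 0"
  shows "rf_zero (Fract N M) z"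
proof -
  have "M \<noteq> 0" using assms(2) by auto
  then have "quot_of_fract (Fract N M) = normalize_quot (N, M)"
    using quot_of_fract_quot_to_fract[of "(N, M)"] by (simp add: quot_to_fract_def)
  moreover obtain e where "N = fst (normalize_quot (N, M)) * e" "M = snd (normalize_quot (N, M)) * e"
    using normalize_quotE[OF \<open>M \<noteq> 0\<close>] by metis
  ultimately have "N = rf_num (Fract N M) * e" "M = rf_den (Fract N M) * e"
    by (simp_all add: rf_num_def rf_den_def)
  then show ?thesis
    using assms by (metis mult_eq_0_iff poly_mult rf_zero_def)
qed

lemma coprime_poly_bezout:
  fixes A B U V :: "complex poly"
  assumes "A * U + B * V = [:2:]"
  shows "coprime A B"
proof (rule coprimeI)
  fix e assume "e dvd A" "e dvd B"
  then have "e dvd [:2:]"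
    using assms by (metis dvd_add dvd_mult2)
  moreover have "is_unit [:2::complex:]" by (rule is_unit_triv) simp
  ultimately show "is_unit e" using dvd_trans by blast
qed

(* For constant f and g the inequality k deg G \<le> deg F can fail under Condition M:
   F = x^2, G = x^3 + 1, c 1 = 0, f = 1, g = 0. *)
lemma constant_counterexample:
  "\<exists>F G k c f g. condition_M F G k c \<and> f holomorphic_on UNIV \<and> g holomorphic_on UNIV \<and>
     rf_comp_eq F f G g \<and> \<not> k * rf_degree G \<le> rf_degree F \<and>
     (\<forall>j\<in>{1..k}. degree (rf_num G) < degree (rf_den G) \<longrightarrow> rf_eval F (c j) \<noteq> 0)"
proof -
  define F :: ratfun where "F = Fract [:0,0,1:] 1"
  define G :: ratfun where "G = Fract [:1,0,0,1:] 1"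
  have [simp]: "rf_num F = [:0,0,1:]" "rf_den F = 1" "rf_num G = [:1,0,0,1:]" "rf_den G = 1"
    unfolding F_def G_def by (simp_all add: quot_of_fract_Fract_monic)
  have "rf_zero (rf_deriv F) 0"
    unfolding rf_deriv_def by (rule rf_zero_Fract) (simp_all add: pderiv_pCons)
  then have "condition_M F G 1 (\<lambda>_. 0)"
    by (simp add: condition_M_def rf_eval_def pderiv_pCons)
  moreover have "rf_comp_eq F (\<lambda>_. 1) G (\<lambda>_. 0)"
    by (simp add: rf_comp_eq_def rf_eval_def rf_pole_def)
  moreover have "\<not> 1 * rf_degree G \<le> rf_degree F"
    by (simp add: rf_degree_def)
  moreover have "(\<lambda>_::complex. 1::complex) holomorphic_on UNIV" "(\<lambda>_::complex. 0::complex) holomorphic_on UNIV"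
    by (simp_all add: holomorphic_on_const)
  ultimately show ?thesis
    by (intro exI[of _ F] exI[of _ G] exI[of _ 1] exI[of _ "\<lambda>_. 0"] exI[of _ "\<lambda>_. 1"]) simp
qed

(* It can also fail for nonconstant f and g if deg C < deg D and F (c j) = 0 for some j, because
   then C - F (c j) * D has degree less than deg G:
   F = (x^2 - x^3) / (x^3 + 1), G = (x^2 - 1) / (x^6 + 1), c 1 = 0, f = exp (-2 z), g = exp z.
   In condition 3 of Condition M this is the missing companion of the case deg C = deg D. *)
lemma zero_value_counterexample:
  "\<exists>F G k c f g. condition_M F G k c \<and> f holomorphic_on UNIV \<and> g holomorphic_on UNIV \<and>
     \<not> f constant_on UNIV \<and> \<not> g constant_on UNIV \<and>
     rf_comp_eq F f G g \<and> \<not> k * rf_degree G \<le> rf_degree F"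
proof -
  define F :: ratfun where "F = Fract [:0,0,1,-1:] [:1,0,0,1:]"
  define G :: ratfun where "G = Fract [:-1,0,1:] [:1,0,0,0,0,0,1:]"
  define f :: "complex \<Rightarrow> complex" where "f = (\<lambda>z. exp (- 2 * z))"
  have "coprime [:0,0,1,-1:] [:1,0,0,1::complex:]"
    by (rule coprime_poly_bezout[where U = "[:1,-1,-1:]" and V = "[:2,0,-1:]"]) simp
  then have [simp]: "rf_num F = [:0,0,1,-1:]" "rf_den F = [:1,0,0,1:]"
    unfolding F_def by (simp_all add: quot_of_fract_Fract_monic)
  have "coprime [:-1,0,1:] [:1,0,0,0,0,0,1::complex:]"
    by (rule coprime_poly_bezout[where U = "[:-1,0,-1,0,-1:]" and V = 1]) simp
  then have [simp]: "rf_num G = [:-1,0,1:]" "rf_den G = [:1,0,0,0,0,0,1:]"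
    unfolding G_def by (simp_all add: quot_of_fract_Fract_monic)
  have "rf_zero (rf_deriv F) 0"
    unfolding rf_deriv_def by (rule rf_zero_Fract) (simp_all add: pderiv_pCons)
  then have "condition_M F G 1 (\<lambda>_. 0)"
    by (simp add: condition_M_def rf_eval_def pderiv_pCons)
  moreover have "rf_comp_eq F f G exp"
  proof -
    have "rf_eval F (f z) = rf_eval G (exp z)"
      if "\<not> rf_pole F (f z)" "\<not> rf_pole G (exp z)" for z
    proof -
      define w where "w = exp z"
      have w: "w \<noteq> 0" by (simp add: w_def)
      have fz: "f z = 1 / w ^ 2"
        by (simp add: f_def w_def exp_minus exp_double divide_inverse)
      have N: "w ^ 6 + 1 \<noteq> 0"
        using that(2) by (simp add: rf_pole_def w_def algebra_simps eval_nat_numeral)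
      have "rf_eval G w = (w ^ 2 - 1) / (w ^ 6 + 1)"
        by (simp add: rf_eval_def algebra_simps eval_nat_numeral)
      moreover have "rf_eval F (1 / w ^ 2) =
          ((1 / w ^ 2) ^ 2 - (1 / w ^ 2) ^ 3) / ((1 / w ^ 2) ^ 3 + 1)"
        by (simp add: rf_eval_def algebra_simps eval_nat_numeral)
      moreover have "(1 / w ^ 2) ^ 2 - (1 / w ^ 2) ^ 3 = (w ^ 2 - 1) / w ^ 6"
        using w by (simp add: field_simps eval_nat_numeral)
      moreover have "(1 / w ^ 2) ^ 3 + 1 = (w ^ 6 + 1) / w ^ 6"
        using w by (simp add: field_simps eval_nat_numeral)
      ultimately show ?thesis
        using w N by (simp add: fz flip: w_def)
    qed
    moreover have "\<not> rf_pole F (f 0)" "\<not> rf_pole G (exp 0)"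
      by (simp_all add: rf_pole_def f_def)
    ultimately show ?thesis unfolding rf_comp_eq_def by blast
  qed
  moreover have "\<not> 1 * rf_degree G \<le> rf_degree F"
    by (simp add: rf_degree_def)
  moreover have "f holomorphic_on UNIV" "exp holomorphic_on (UNIV :: complex set)"
    unfolding f_def by (intro holomorphic_intros)+
  moreover have "\<not> exp constant_on (UNIV :: complex set)"
  proof
    assume "exp constant_on (UNIV :: complex set)"
    then have "exp (0::complex) = exp (\<i> * of_real pi)"
      unfolding constant_on_def by (metis UNIV_I)
    then show False by simp
  qed
  moreover have "\<not> f constant_on UNIV"
  proof
    assume "f constant_on UNIV"
    then have "f 0 = f (- (\<i> * of_real pi) / 2)"
      unfolding constant_on_def by (metis UNIV_I)
    then show False by (simp add: f_def)
  qed
  ultimately show ?thesis by blast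
qed

end

(* Writing F = A/B and G = C/D in lowest terms, the equation F(f) = G(g) is equivalent to
   A(f) = U C(g), B(f) = U D(g) with a zero-free entire U = exp h. Put w j = F(c j),
   P = prod (A - w j B), E = prod (C - w j D), and let R be the product of the radicals of the
   factors of P. Condition M makes E squarefree of degree k q, and since c j is a multiple zero of
   A - w j B, deg R is at most deg P - k. Suppose k q > p. As P(f) = U^k E(g), the function
   V = R(f) g' / E(g) is entire, and for suitable s < 0 the function W = V exp (s h) is so small
   compared with g' and f' that |W|, multiplied by a slowly growing weight in |f| and |g|, is a
   conformal pseudometric on the plane with curvature bounded above by a negative constant. By
   the Ahlfors-Schwarz lemma it vanishes, although R(f) g' is not identically zero. This replaces
   the second main theorem of Nevanlinna theory. *)
theory Submission
  imports Defs
begin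

section \<open>Laplacians and the Ahlfors-Schwarz lemma\<close>

text \<open>V has no poles because E is squarefree: at a zero of E(g) the quotient g' / E(g) has at
  most a simple pole, and R(f) vanishes there since P(f) does. The link between f and g is growth.
  Neither A, B nor C, D have a common zero, so, with |x| read as sqrt (1 + |x|^2), the quantities
  |f|^p and |U| |g|^q agree up to constant factors. Where g is large, |V| is at most a constant
  times |f|^(k (p - 1)) |g'| / |g|^(k q). Multiplying by |U|^s with s = - k (p - 1) / p and
  eliminating |U| removes f and leaves |g'| |g|^(- k q / p). This exponent is below -1 exactly when
  k q > p, and |g'| |g|^(- 1 - \<epsilon>) is the size that the Laplacian of a slowly growing weight
  can dominate. The actual s is shifted by a multiple of \<epsilon> in order to absorb the weight
  itself.\<close>

definition has_dir_derivs ::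
  "(complex \<Rightarrow> real) \<Rightarrow> complex \<Rightarrow> complex \<Rightarrow> real \<Rightarrow> real \<Rightarrow> bool" where
  "has_dir_derivs \<Phi> e z m D \<longleftrightarrow> (\<exists>\<Phi>'. \<Phi>' 0 = m \<and>
     (\<forall>\<^sub>F t in nhds 0. ((\<lambda>t. \<Phi> (z + of_real t * e)) has_real_derivative \<Phi>' t) (at t)) \<and>
     (\<Phi>' has_real_derivative D) (at 0))"

lemma isCont_imp_filterlim_nhds: "isCont f x \<Longrightarrow> filterlim f (nhds (f x)) (nhds x)"
  unfolding isCont_def by (simp add: tendsto_at_iff_tendsto_nhds)

lemma has_dir_derivs_add:
  assumes "has_dir_derivs \<Phi> e z m D" "has_dir_derivs \<Psi> e z n E"
  shows "has_dir_derivs (\<lambda>x. \<Phi> x + \<Psi> x) e z (m + n) (D + E)"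
proof -
  obtain \<Phi>' \<Psi>' where
    *: "\<Phi>' 0 = m" "\<forall>\<^sub>F t in nhds 0. ((\<lambda>t. \<Phi> (z + of_real t * e)) has_real_derivative \<Phi>' t) (at t)"
      "(\<Phi>' has_real_derivative D) (at 0)"
    and **: "\<Psi>' 0 = n" "\<forall>\<^sub>F t in nhds 0. ((\<lambda>t. \<Psi> (z + of_real t * e)) has_real_derivative \<Psi>' t) (at t)"
      "(\<Psi>' has_real_derivative E) (at 0)"
    using assms unfolding has_dir_derivs_def by blast
  show ?thesis
    unfolding has_dir_derivs_def
  proof (intro exI[of _ "\<lambda>t. \<Phi>' t + \<Psi>' t"] conjI)
    show "\<forall>\<^sub>F t in nhds 0. ((\<lambda>t. \<Phi> (z + of_real t * e) + \<Psi> (z + of_real t * e))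
            has_real_derivative \<Phi>' t + \<Psi>' t) (at t)"
      using *(2) **(2) by eventually_elim (rule DERIV_add)
  qed (use * ** in \<open>auto intro: DERIV_add\<close>)
qed

lemma has_dir_derivs_compose:
  assumes \<Phi>: "has_dir_derivs \<Phi> e z m D"
    and \<kappa>: "\<forall>\<^sub>F s in nhds (\<Phi> z). (\<kappa> has_real_derivative \<kappa>' s) (at s)"
    and \<kappa>': "(\<kappa>' has_real_derivative \<kappa>'') (at (\<Phi> z))"
  shows "has_dir_derivs (\<lambda>x. \<kappa> (\<Phi> x)) e z (\<kappa>' (\<Phi> z) * m) (\<kappa>'' * m\<^sup>2 + \<kappa>' (\<Phi> z) * D)"
proof -
  obtain \<Phi>' where
    *: "\<Phi>' 0 = m" "\<forall>\<^sub>F t in nhds 0. ((\<lambda>t. \<Phi> (z + of_real t * e)) has_real_derivative \<Phi>' t) (at t)"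
      "(\<Phi>' has_real_derivative D) (at 0)"
    using assms unfolding has_dir_derivs_def by blast
  let ?p = "\<lambda>t::real. \<Phi> (z + of_real t * e)"
  have d0: "(?p has_real_derivative \<Phi>' 0) (at 0)"
    using eventually_nhds_x_imp_x[OF *(2)] .
  then have "isCont ?p 0" by (rule DERIV_isCont)
  then have lim: "filterlim ?p (nhds (\<Phi> z)) (nhds 0)"
    using isCont_imp_filterlim_nhds by fastforce
  have ev: "\<forall>\<^sub>F t in nhds 0. (\<kappa> has_real_derivative \<kappa>' (?p t)) (at (?p t))"
    using eventually_compose_filterlim[OF \<kappa> lim] .
  show ?thesis
    unfolding has_dir_derivs_def
  proof (intro exI[of _ "\<lambda>t. \<kappa>' (?p t) * \<Phi>' t"] conjI)
    show "\<forall>\<^sub>F t in nhds 0. ((\<lambda>t. \<kappa> (?p t)) has_real_derivative \<kappa>' (?p t) * \<Phi>' t) (at t)"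
      using ev *(2) by eventually_elim (rule DERIV_chain2)
    have "((\<lambda>t. \<kappa>' (?p t)) has_real_derivative \<kappa>'' * \<Phi>' 0) (at 0)"
      by (rule DERIV_chain2[OF _ d0]) (use \<kappa>' in simp)
    from DERIV_mult[OF this *(3)]
    show "((\<lambda>t. \<kappa>' (?p t) * \<Phi>' t) has_real_derivative \<kappa>'' * m\<^sup>2 + \<kappa>' (\<Phi> z) * D) (at 0)"
      by (simp add: *(1) power2_eq_square algebra_simps)
  qed (use * in simp)
qed

lemma has_dir_derivs_Re:
  assumes "L holomorphic_on S" "open S" "z \<in> S"
  shows "has_dir_derivs (\<lambda>x. Re (L x)) e z (Re (e * deriv L z)) (Re (e\<^sup>2 * deriv (deriv L) z))"
proof -
  have d: "((\<lambda>t. Re (c * M (z + of_real t * e))) has_real_derivative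
              Re (c * (e * deriv M (z + of_real t * e)))) (at t)"
    if "M holomorphic_on S" "z + of_real t * e \<in> S" for M :: "complex \<Rightarrow> complex" and c t
  proof -
    have "(M has_field_derivative deriv M (z + of_real t * e)) (at (z + of_real t * e))"
      using that assms(2) holomorphic_derivI by blast
    moreover have "((\<lambda>t::real. z + of_real t * e) has_vector_derivative e) (at t)"
      by (auto intro!: derivative_eq_intros)
    ultimately have "((M \<circ> (\<lambda>t::real. z + of_real t * e)) has_vector_derivative
        e * deriv M (z + of_real t * e)) (at t)"
      by (intro field_vector_diff_chain_at)
    then have "((\<lambda>t. Re (c * (M (z + of_real t * e)))) has_vector_derivative
        Re (c * (e * deriv M (z + of_real t * e)))) (at t)"
      unfolding o_def
      by (intro bounded_linear.has_vector_derivative[OF bounded_linear_compose[OF bounded_linear_Re bounded_linear_mult_right]])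
    then show ?thesis
      by (simp add: has_real_derivative_iff_has_vector_derivative)
  qed
  have "isCont (\<lambda>t::real. z + of_real t * e) 0" by (intro continuous_intros)
  then have "filterlim (\<lambda>t::real. z + of_real t * e) (nhds z) (nhds 0)"
    using isCont_imp_filterlim_nhds by fastforce
  then have ev: "\<forall>\<^sub>F t::real in nhds 0. z + of_real t * e \<in> S"
    using eventually_compose_filterlim[OF eventually_nhds_in_open[OF assms(2,3)]] by blast
  show ?thesis
    unfolding has_dir_derivs_def
  proof (intro exI[of _ "\<lambda>t. Re (e * deriv L (z + of_real t * e))"] conjI)
    show "\<forall>\<^sub>F t in nhds 0. ((\<lambda>t. Re (L (z + of_real t * e))) has_real_derivative
            Re (e * deriv L (z + of_real t * e))) (at t)"
      using ev by eventually_elim (use d[of L _ 1] assms(1) in simp)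
    show "((\<lambda>t. Re (e * deriv L (z + of_real t * e))) has_real_derivative
            Re (e\<^sup>2 * deriv (deriv L) z)) (at 0)"
      using d[OF holomorphic_deriv[OF assms(1,2)], of 0 e] assms(3)
      by (simp add: power2_eq_square mult.assoc)
  qed simp
qed

text \<open>Since |L|^2 = (Re L)^2 + (Re (- \<i> L))^2, the imaginary part is again the real part of
  a holomorphic function, and only squaring has to be composed with
  \<open>has_dir_derivs_Re\<close>.\<close>

lemma has_dir_derivs_cmod_square:
  assumes "L holomorphic_on S" "open S" "z \<in> S"
  shows "has_dir_derivs (\<lambda>x. (cmod (L x))\<^sup>2) e z (2 * Re (e * deriv L z * cnj (L z)))
           (2 * (cmod (e * deriv L z))\<^sup>2 + 2 * Re (e\<^sup>2 * deriv (deriv L) z * cnj (L z)))"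
proof -
  have sq: "has_dir_derivs (\<lambda>x. (Re (M x))\<^sup>2) e z (2 * Re (M z) * Re (e * deriv M z))
     (2 * (Re (e * deriv M z))\<^sup>2 + 2 * Re (M z) * Re (e\<^sup>2 * deriv (deriv M) z))"
    if "M holomorphic_on S" for M
    by (rule has_dir_derivs_compose[OF has_dir_derivs_Re[OF that assms(2,3)],
          where \<kappa> = "\<lambda>s. s\<^sup>2" and \<kappa>' = "\<lambda>s. 2 * s"])
      (auto intro!: derivative_eq_intros always_eventually)
  have d: "deriv (\<lambda>x. - \<i> * L x) x = - \<i> * deriv L x" if "x \<in> S" for x
    using that assms holomorphic_on_imp_differentiable_at by (intro deriv_cmult) blast
  have "deriv (deriv (\<lambda>x. - \<i> * L x)) z = deriv (\<lambda>x. - \<i> * deriv L x) z"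
    by (intro deriv_cong_ev eventually_mono[OF eventually_nhds_in_open[OF assms(2,3)]] d refl)
  also have "\<dots> = - \<i> * deriv (deriv L) z"
    using assms holomorphic_deriv holomorphic_on_imp_differentiable_at by (intro deriv_cmult) blast
  finally have dd: "deriv (deriv (\<lambda>x. - \<i> * L x)) z = - \<i> * deriv (deriv L) z" .
  have "(\<lambda>x. - \<i> * L x) holomorphic_on S"
    by (intro holomorphic_intros assms)
  note sq[OF this]
  from has_dir_derivs_add[OF sq[OF assms(1)] this]
  have "has_dir_derivs (\<lambda>x. (Re (L x))\<^sup>2 + (Im (L x))\<^sup>2) e z
      (2 * Re (L z) * Re (e * deriv L z) + 2 * Im (L z) * Re (e * (- \<i> * deriv L z)))
      (2 * (Re (e * deriv L z))\<^sup>2 + 2 * Re (L z) * Re (e\<^sup>2 * deriv (deriv L) z) +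
       (2 * (Re (e * (- \<i> * deriv L z)))\<^sup>2 + 2 * Im (L z) * Re (e\<^sup>2 * (- \<i> * deriv (deriv L) z))))"
    unfolding dd d[OF assms(3)] by simp
  then show ?thesis
    by (simp add: cmod_power2 algebra_simps)
qed

text \<open>A pointwise relation suffices, as Laplacians are only compared at one maximum point.
  \<open>has_dir_derivs\<close> carries the first derivative along because the chain rule for second
  derivatives involves its square.\<close>

definition has_laplacian :: "(complex \<Rightarrow> real) \<Rightarrow> real \<Rightarrow> complex \<Rightarrow> bool" where
  "has_laplacian \<Phi> l z \<longleftrightarrow>
     (\<exists>m n D E. has_dir_derivs \<Phi> 1 z m D \<and> has_dir_derivs \<Phi> \<i> z n E \<and> l = D + E)"

lemma has_laplacian_add:
  assumes "has_laplacian \<Phi> a z" "has_laplacian \<Psi> b z"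
  shows "has_laplacian (\<lambda>x. \<Phi> x + \<Psi> x) (a + b) z"
proof -
  obtain m n D E m' n' D' E' where
    *: "has_dir_derivs \<Phi> 1 z m D" "has_dir_derivs \<Phi> \<i> z n E" "a = D + E"
    "has_dir_derivs \<Psi> 1 z m' D'" "has_dir_derivs \<Psi> \<i> z n' E'" "b = D' + E'"
    using assms unfolding has_laplacian_def by blast
  have "a + b = (D + D') + (E + E')" using * by simp
  then show ?thesis
    unfolding has_laplacian_def using * has_dir_derivs_add by blast
qed

text \<open>The second derivative in direction e is Re (e^2 L''), and the squares of 1 and \<i>
  cancel.\<close>

lemma has_laplacian_Re:
  assumes "L holomorphic_on S" "open S" "z \<in> S"
  shows "has_laplacian (\<lambda>x. Re (L x)) 0 z"
  unfolding has_laplacian_def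
  using has_dir_derivs_Re[OF assms, of 1] has_dir_derivs_Re[OF assms, of \<i>]
  by (intro exI conjI) (assumption | simp)+

text \<open>The terms with L'' cancel between the directions 1 and \<i>, and the squared first
  derivatives add up to 4 |L'|^2 |L|^2, because they are the squares of the real and imaginary part
  of one complex number.\<close>

lemma has_laplacian_radial:
  assumes L: "L holomorphic_on S" "open S" "z \<in> S"
    and \<kappa>: "\<forall>\<^sub>F s in nhds ((cmod (L z))\<^sup>2). (\<kappa> has_real_derivative \<kappa>' s) (at s)"
    and \<kappa>': "(\<kappa>' has_real_derivative \<kappa>'') (at ((cmod (L z))\<^sup>2))"
  shows "has_laplacian (\<lambda>x. \<kappa> ((cmod (L x))\<^sup>2))
           (4 * (cmod (deriv L z))\<^sup>2 * (\<kappa>' ((cmod (L z))\<^sup>2) + (cmod (L z))\<^sup>2 * \<kappa>'')) z"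
proof -
  note * = has_dir_derivs_compose[OF has_dir_derivs_cmod_square[OF L] \<kappa> \<kappa>']
  let ?m = "\<lambda>e. \<kappa>' ((cmod (L z))\<^sup>2) * (2 * Re (e * deriv L z * cnj (L z)))"
  let ?D = "\<lambda>e. \<kappa>'' * (2 * Re (e * deriv L z * cnj (L z)))\<^sup>2 + \<kappa>' ((cmod (L z))\<^sup>2) *
    (2 * (cmod (e * deriv L z))\<^sup>2 + 2 * Re (e\<^sup>2 * deriv (deriv L) z * cnj (L z)))"
  show ?thesis
    unfolding has_laplacian_def
  proof (intro exI conjI)
    show "has_dir_derivs (\<lambda>x. \<kappa> ((cmod (L x))\<^sup>2)) 1 z (?m 1) (?D 1)" by (rule *)
    show "has_dir_derivs (\<lambda>x. \<kappa> ((cmod (L x))\<^sup>2)) \<i> z (?m \<i>) (?D \<i>)" by (rule *)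
    next
    let ?l = "L z" and ?d = "deriv L z"
    have "(cmod ?d)\<^sup>2 * (cmod ?l)\<^sup>2 = (Re (?d * cnj ?l))\<^sup>2 + (Im (?d * cnj ?l))\<^sup>2"
      by (metis cmod_power2 complex_mod_cnj norm_mult power_mult_distrib)
    then show "4 * (cmod ?d)\<^sup>2 * (\<kappa>' ((cmod ?l)\<^sup>2) + (cmod ?l)\<^sup>2 * \<kappa>'') = ?D 1 + ?D \<i>"
      by (simp add: norm_mult algebra_simps power2_eq_square)
  qed
qed

section \<open>Maximum principle and comparison with the hyperbolic metric\<close>

lemma second_derivative_nonpos_at_max:
  fixes h :: "real \<Rightarrow> real"
  assumes h: "\<forall>\<^sub>F t in nhds 0. (h has_real_derivative h' t) (at t)"
    and h': "(h' has_real_derivative D) (at 0)"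
    and max: "\<forall>\<^sub>F t in nhds 0. h t \<le> h 0"
  shows "D \<le> 0"
proof (rule ccontr)
  assume "\<not> D \<le> 0"
  obtain d1 where d1: "d1 > 0" "\<And>t. \<bar>t\<bar> < d1 \<Longrightarrow> (h has_real_derivative h' t) (at t)"
    using h unfolding eventually_nhds_metric by (auto simp: dist_real_def)
  obtain d2 where d2: "d2 > 0" "\<And>t. \<bar>t\<bar> < d2 \<Longrightarrow> h t \<le> h 0"
    using max unfolding eventually_nhds_metric by (auto simp: dist_real_def)
  have "h' 0 = 0"
    by (rule DERIV_local_max[of h _ 0 "min d1 d2"]) (use d1 d2 in auto)
  obtain d3 where d3: "d3 > 0" "\<And>t. 0 < t \<Longrightarrow> t < d3 \<Longrightarrow> h' 0 < h' t"
    using DERIV_pos_inc_right[OF h'] \<open>\<not> D \<le> 0\<close> by force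
  define t where "t = min d1 (min d2 d3) / 2"
  have t: "0 < t" "t < d1" "t < d2" "t < d3" using d1 d2 d3 by (auto simp: t_def)
  obtain x where "0 < x" "x < t" "h t - h 0 = (t - 0) * h' x"
    using MVT2[of 0 t h h'] t d1(2) by (metis abs_of_nonneg order.strict_trans1)
  moreover from this have "t * h' x > 0"
    using d3(2)[of x] \<open>h' 0 = 0\<close> t by simp
  ultimately have "h t > h 0" by simp
  then show False using d2(2)[of t] t by auto
qed

lemma laplacian_nonpos_at_max:
  assumes "has_laplacian \<Phi> l z" and max: "\<forall>\<^sub>F x in nhds z. \<Phi> x \<le> \<Phi> z"
  shows "l \<le> 0"
proof -
  have dir: "D \<le> 0" if D: "has_dir_derivs \<Phi> e z m D" for e m D
  proof -
    obtain \<Phi>' where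
      *: "\<forall>\<^sub>F t in nhds 0. ((\<lambda>t. \<Phi> (z + of_real t * e)) has_real_derivative \<Phi>' t) (at t)"
      "(\<Phi>' has_real_derivative D) (at 0)"
      using D unfolding has_dir_derivs_def by blast
    have "isCont (\<lambda>t::real. z + of_real t * e) 0" by (intro continuous_intros)
    then have "filterlim (\<lambda>t::real. z + of_real t * e) (nhds z) (nhds 0)"
      using isCont_imp_filterlim_nhds by fastforce
    then have "\<forall>\<^sub>F t::real in nhds 0. \<Phi> (z + of_real t * e) \<le> \<Phi> (z + of_real 0 * e)"
      using eventually_compose_filterlim[OF max] by simp
    with second_derivative_nonpos_at_max[OF *] show ?thesis .
  qed
  from assms(1) show ?thesis
    unfolding has_laplacian_def using dir by (metis add_nonpos_nonpos)
qed

text \<open>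
  The Laplacian of \<open>\<kappa> (|h|^2)\<close> for holomorphic \<open>h\<close> is \<open>4 |h'|^2 (\<kappa>' + s \<kappa>'')\<close> at
  \<open>s = |h|^2\<close>. For this \<open>\<kappa>\<close> the lower bound decays only like \<open>|h|^(- 2 - 2 \<epsilon>)\<close>, whereas
  \<open>ln (1 + s)\<close> would give \<open>|h|^(- 4)\<close>, which is too small when \<open>k q / p\<close> is close to 1.
\<close>
lemma radial_weight_derivs:
  fixes s \<epsilon> :: real
  assumes "s \<ge> 0" "0 < \<epsilon>" "\<epsilon> \<le> 1"
  defines "\<kappa>' \<equiv> \<lambda>s. \<epsilon> * (1 + s) powr (\<epsilon> - 1) / (1 + (1 + s) powr \<epsilon>)"
  shows "\<forall>\<^sub>F x in nhds s. ((\<lambda>s. ln (1 + (1 + s) powr \<epsilon>)) has_real_derivative \<kappa>' x) (at x)"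
    and "\<exists>\<kappa>''. (\<kappa>' has_real_derivative \<kappa>'') (at s) \<and>
           \<kappa>' s + s * \<kappa>'' \<ge> \<epsilon>\<^sup>2 / 4 * (1 + s) powr (- 1 - \<epsilon>)"
proof -
  have "\<forall>\<^sub>F x in nhds s. x \<in> {-1<..}"
    by (rule eventually_nhds_in_open) (use assms in auto)
  then show "\<forall>\<^sub>F x in nhds s. ((\<lambda>s. ln (1 + (1 + s) powr \<epsilon>)) has_real_derivative \<kappa>' x) (at x)"
  proof eventually_elim
    case (elim x)
    then have "1 + (1 + x) powr \<epsilon> > 0" by (simp add: add_pos_nonneg)
    then show ?case
      unfolding \<kappa>'_def using elim
      by (auto intro!: derivative_eq_intros simp: divide_inverse algebra_simps)
  qed
next
  define v where "v = (1 + s) powr \<epsilon>"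
  have v: "v \<ge> 1" unfolding v_def using assms by (simp add: ge_one_powr_ge_zero)
  define w where "w = 1 + s"
  have w: "w \<ge> 1" "s = w - 1" using assms by (auto simp: w_def)
  have p1: "(1 + s) powr (\<epsilon> - 1) = v / w"
    unfolding v_def w_def using assms by (simp add: powr_diff)
  have p2: "(1 + s) powr (\<epsilon> - 2) = v / w\<^sup>2"
    unfolding v_def w_def using assms(1) by (simp add: powr_diff)
  have p3: "(1 + s) powr (- 1 - \<epsilon>) = 1 / (w * v)"
    unfolding v_def w_def using assms(1) by (simp add: powr_diff powr_minus field_simps)
  define \<kappa>'' where "\<kappa>'' = (\<epsilon> * ((\<epsilon> - 1) * (v / w\<^sup>2)) * (1 + v) - \<epsilon> * (v / w) * (\<epsilon> * (v / w))) / (1 + v)\<^sup>2"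
  have "1 + (1 + s) powr \<epsilon> \<noteq> 0" using v unfolding v_def by linarith
  moreover have "1 + s > 0" using assms by simp
  ultimately have "(\<kappa>' has_real_derivative \<kappa>'') (at s)"
    unfolding \<kappa>'_def \<kappa>''_def
    by (auto intro!: derivative_eq_intros simp flip: v_def simp: p1 p2 power2_eq_square)
  moreover have "\<kappa>' s + s * \<kappa>'' \<ge> \<epsilon>\<^sup>2 / 4 * (1 + s) powr (- 1 - \<epsilon>)"
  proof -
    have "\<kappa>' s + s * \<kappa>'' = \<epsilon> * v * (1 + v + (w - 1) * \<epsilon>) / (w\<^sup>2 * (1 + v)\<^sup>2)"
    proof -
      have "\<kappa>' s + s * \<kappa>'' = \<epsilon> * (v / w) / (1 + v) + (w - 1) * \<kappa>''"
        unfolding \<kappa>'_def p1 v_def[symmetric] w_def by simp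
      also have "\<dots> = \<epsilon> * v * (1 + v + (w - 1) * \<epsilon>) / (w\<^sup>2 * (1 + v)\<^sup>2)"
        unfolding \<kappa>''_def using w(1) v
        by (simp add: divide_simps power2_eq_square) (simp add: algebra_simps)
      finally show ?thesis .
    qed
    \<comment> \<open>Here \<epsilon> \<le> 1 \<le> 1 + v is used to keep only \<epsilon> w of the
      bracket. Afterwards 1 + v \<le> 2 v produces the factor 1/4.\<close>
    also have "\<dots> \<ge> \<epsilon> * v * (\<epsilon> * w) / (w\<^sup>2 * (1 + v)\<^sup>2)"
      using assms v w by (intro divide_right_mono mult_left_mono) (auto simp: algebra_simps)
    also have "\<epsilon> * v * (\<epsilon> * w) / (w\<^sup>2 * (1 + v)\<^sup>2) = \<epsilon>\<^sup>2 * v / (w * (1 + v)\<^sup>2)"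
      using w(1) v by (simp add: power2_eq_square)
    also have "\<dots> \<ge> \<epsilon>\<^sup>2 * v / (w * (2 * v)\<^sup>2)"
      using w v by (intro divide_left_mono mult_left_mono power_mono mult_pos_pos) auto
    also have "\<epsilon>\<^sup>2 * v / (w * (2 * v)\<^sup>2) = \<epsilon>\<^sup>2 / 4 * (1 + s) powr (- 1 - \<epsilon>)"
      unfolding p3 using w v by (simp add: power2_eq_square field_simps)
    finally show ?thesis by simp
  qed
  ultimately show "\<exists>\<kappa>''. (\<kappa>' has_real_derivative \<kappa>'') (at s) \<and>
           \<kappa>' s + s * \<kappa>'' \<ge> \<epsilon>\<^sup>2 / 4 * (1 + s) powr (- 1 - \<epsilon>)" by blast
qed

text \<open>The density |W| (1 + \<mu> f) (1 + \<mu> g) has a logarithm whose Laplacian, off the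
  zeros of W, is at least \<epsilon>^2 times the bracket in \<open>bound\<close>, hence at least a
  multiple of the squared density. Comparison with the hyperbolic metric of the disc of radius r,
  whose density is 2 r / (r^2 - |x|^2), bounds it at z by O(1 / r), and r is arbitrary.\<close>

lemma ahlfors_schwarz:
  fixes f g W :: "complex \<Rightarrow> complex" and \<epsilon> K :: real
  assumes f: "f holomorphic_on UNIV" and g: "g holomorphic_on UNIV" and W: "W holomorphic_on UNIV"
    and \<epsilon>: "0 < \<epsilon>" "\<epsilon> \<le> 1"
  defines "\<mu> \<equiv> \<lambda>h z. (1 + (cmod (h z))\<^sup>2) powr \<epsilon>"
  assumes bound: "\<And>z. (cmod (W z) * (1 + \<mu> f z) * (1 + \<mu> g z))\<^sup>2 \<le>
      K * ((cmod (deriv f z))\<^sup>2 * (1 + (cmod (f z))\<^sup>2) powr (- 1 - \<epsilon>) +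
           (cmod (deriv g z))\<^sup>2 * (1 + (cmod (g z))\<^sup>2) powr (- 1 - \<epsilon>))"
  shows "W z = 0"
proof (rule ccontr)
  assume "W z \<noteq> 0"
  define \<Lambda> where "\<Lambda> = (\<lambda>z. cmod (W z) * (1 + \<mu> f z) * (1 + \<mu> g z))"
  have cont: "continuous_on UNIV f" "continuous_on UNIV g" "continuous_on UNIV W"
    using f g W holomorphic_on_imp_continuous_on by blast+
  have pos: "1 + (cmod w)\<^sup>2 > 0" for w by (simp add: add_pos_nonneg)
  have \<mu>_pos: "1 + \<mu> h z > 0" for h z unfolding \<mu>_def by (simp add: add_pos_nonneg)
  have "continuous_on UNIV (\<mu> h)" if "continuous_on UNIV h" for h
    unfolding \<mu>_def using that pos by (auto intro!: continuous_intros simp: less_imp_neq[symmetric])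
  then have contL: "continuous_on A \<Lambda>" for A
    unfolding \<Lambda>_def using cont by (intro continuous_intros) (auto intro: continuous_on_subset)
  have \<Lambda>_pos: "\<Lambda> x \<ge> 0" for x unfolding \<Lambda>_def using \<mu>_pos by (simp add: less_imp_le)
  have "\<Lambda> z > 0" unfolding \<Lambda>_def using \<mu>_pos \<open>W z \<noteq> 0\<close> by simp
  \<comment> \<open>The 4 comes from the Laplacian of ln (r^2 - |x|^2) and \<epsilon>^2 from the
    radial weights. The absolute value gives \<open>K'\<close> a sign, as nothing is assumed about
    that of K.\<close>
  define K' where "K' = 4 * \<bar>K\<bar> / \<epsilon>\<^sup>2"
  have K': "K' \<ge> 0" unfolding K'_def by simp
  have main: "(\<Lambda> z * (r\<^sup>2 - (cmod z)\<^sup>2))\<^sup>2 \<le> K' * r\<^sup>2" if r: "r > cmod z" for r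
  proof -
    have r0: "r > 0" using r norm_ge_zero[of z] by linarith
    define M where "M = (\<lambda>x. \<Lambda> x * (r\<^sup>2 - (cmod x)\<^sup>2))"
    have "continuous_on (cball 0 r) M"
      unfolding M_def by (intro continuous_intros contL)
    moreover have "cball 0 r \<noteq> ({}::complex set)" using r0 by auto
    ultimately obtain x where x: "x \<in> cball 0 r" "\<And>y. y \<in> cball 0 r \<Longrightarrow> M y \<le> M x"
      using continuous_attains_sup[OF compact_cball] by metis
    \<comment> \<open>M is positive at z and zero on the boundary circle, so the maximum is attained
      inside, at a point where W does not vanish and ln M is defined.\<close>
    have "M z > 0"
      unfolding M_def using \<open>\<Lambda> z > 0\<close> r by (simp add: power_strict_mono)
    moreover have Mz: "M z \<le> M x" using x(2) r by simp
    ultimately have Mx: "M x > 0" by linarith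
    have Wx: "W x \<noteq> 0" using Mx unfolding M_def \<Lambda>_def by auto
    have "r\<^sup>2 - (cmod x)\<^sup>2 > 0" using Mx \<Lambda>_pos[of x] unfolding M_def by (simp add: zero_less_mult_iff)
    then have xr: "cmod x < r" "(cmod x)\<^sup>2 < r\<^sup>2"
      using power2_less_imp_less[of "cmod x" r] r0 by auto
    have "\<forall>\<^sub>F y in nhds x. y \<in> ball 0 r \<and> W y \<noteq> 0"
    proof (rule eventually_conj)
      show "\<forall>\<^sub>F y in nhds x. W y \<noteq> 0"
        using eventually_nhds_in_open[OF open_Collect_neq[OF cont(3) continuous_on_const]] Wx by auto
    qed (use xr in \<open>intro eventually_nhds_in_open; simp\<close>)
    then obtain d where d: "d > 0" "\<And>y. y \<in> ball x d \<Longrightarrow> y \<in> ball 0 r \<and> W y \<noteq> 0"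
      unfolding eventually_nhds_metric by (auto simp: dist_commute)
    \<comment> \<open>A local holomorphic logarithm of W turns ln |W| into the harmonic function Re
      L, which contributes 0 to the Laplacian.\<close>
    obtain L where L: "L holomorphic_on ball x d" "\<And>y. y \<in> ball x d \<Longrightarrow> W y = exp (L y)"
      using contractible_imp_holomorphic_log[of W "ball x d"] d W
      by (metis convex_ball convex_imp_contractible holomorphic_on_subset subset_UNIV)
    have S: "open (ball x d)" "x \<in> ball x d" using d by auto
    have hol: "f holomorphic_on ball x d" "g holomorphic_on ball x d" "(\<lambda>x. x) holomorphic_on ball x d"
      using f g holomorphic_on_subset by (auto intro: holomorphic_intros)
    define \<kappa> where "\<kappa> = (\<lambda>s::real. ln (1 + (1 + s) powr \<epsilon>))"
    have rad: "\<exists>l. has_laplacian (\<lambda>x. \<kappa> ((cmod (h x))\<^sup>2)) l x \<and>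
        l \<ge> \<epsilon>\<^sup>2 * (cmod (deriv h x))\<^sup>2 * (1 + (cmod (h x))\<^sup>2) powr (- 1 - \<epsilon>)"
      if "h holomorphic_on ball x d" for h
    proof -
      define s where "s = (cmod (h x))\<^sup>2"
      have "s \<ge> 0" by (simp add: s_def)
      note * = radial_weight_derivs[OF this \<epsilon>, folded \<kappa>_def]
      obtain \<kappa>'' where k2: "((\<lambda>s. \<epsilon> * (1 + s) powr (\<epsilon> - 1) / (1 + (1 + s) powr \<epsilon>)) has_real_derivative \<kappa>'') (at s)"
        "\<epsilon> * (1 + s) powr (\<epsilon> - 1) / (1 + (1 + s) powr \<epsilon>) + s * \<kappa>'' \<ge> \<epsilon>\<^sup>2 / 4 * (1 + s) powr (- 1 - \<epsilon>)"
        using *(2) by blast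
      note lap = has_laplacian_radial[OF that S, folded s_def, OF *(1) k2(1)]
      have "4 * (cmod (deriv h x))\<^sup>2 * (\<epsilon>\<^sup>2 / 4 * (1 + s) powr (- 1 - \<epsilon>)) \<le> 4 * (cmod (deriv h x))\<^sup>2 *
        (\<epsilon> * (1 + s) powr (\<epsilon> - 1) / (1 + (1 + s) powr \<epsilon>) + s * \<kappa>'')"
        by (rule mult_left_mono[OF k2(2)]) simp
      then show ?thesis using lap unfolding s_def by (auto simp: mult_ac)
    qed
    obtain l1 where l1: "has_laplacian (\<lambda>x. \<kappa> ((cmod (f x))\<^sup>2)) l1 x"
        "l1 \<ge> \<epsilon>\<^sup>2 * (cmod (deriv f x))\<^sup>2 * (1 + (cmod (f x))\<^sup>2) powr (- 1 - \<epsilon>)"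
      using rad hol by blast
    obtain l2 where l2: "has_laplacian (\<lambda>x. \<kappa> ((cmod (g x))\<^sup>2)) l2 x"
        "l2 \<ge> \<epsilon>\<^sup>2 * (cmod (deriv g x))\<^sup>2 * (1 + (cmod (g x))\<^sup>2) powr (- 1 - \<epsilon>)"
      using rad hol by blast
    have l3: "has_laplacian (\<lambda>x. ln (r\<^sup>2 - (cmod x)\<^sup>2)) (- 4 * r\<^sup>2 / (r\<^sup>2 - (cmod x)\<^sup>2)\<^sup>2) x"
    proof -
      have ev: "\<forall>\<^sub>F s in nhds ((cmod x)\<^sup>2). ((\<lambda>s. ln (r\<^sup>2 - s)) has_real_derivative - 1 / (r\<^sup>2 - s)) (at s)"
      proof -
        have "\<forall>\<^sub>F s in nhds ((cmod x)\<^sup>2). s \<in> {..<r\<^sup>2}"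
          by (rule eventually_nhds_in_open) (use xr in auto)
        then show ?thesis
          by eventually_elim (auto intro!: derivative_eq_intros)
      qed
      have "((\<lambda>s. - 1 / (r\<^sup>2 - s)) has_real_derivative - 1 / (r\<^sup>2 - (cmod x)\<^sup>2)\<^sup>2) (at ((cmod x)\<^sup>2))"
        using xr(2) by (auto intro!: derivative_eq_intros simp: power2_eq_square)
      from has_laplacian_radial[OF hol(3) S ev this]
      have "has_laplacian (\<lambda>x. ln (r\<^sup>2 - (cmod x)\<^sup>2))
        (4 * (- 1 / (r\<^sup>2 - (cmod x)\<^sup>2) + (cmod x)\<^sup>2 * (- 1 / (r\<^sup>2 - (cmod x)\<^sup>2)\<^sup>2))) x"
        by simp
      moreover have "4 * (- 1 / u + v * (- 1 / u\<^sup>2)) = - 4 * (u + v) / u\<^sup>2" if "u \<noteq> 0" for u v :: real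
        using that by (simp add: field_simps power2_eq_square)
      from this[of "r\<^sup>2 - (cmod x)\<^sup>2" "(cmod x)\<^sup>2"] have
        "4 * (- 1 / (r\<^sup>2 - (cmod x)\<^sup>2) + (cmod x)\<^sup>2 * (- 1 / (r\<^sup>2 - (cmod x)\<^sup>2)\<^sup>2)) =
           - 4 * r\<^sup>2 / (r\<^sup>2 - (cmod x)\<^sup>2)\<^sup>2" using xr(2) by simp
      ultimately show ?thesis by simp
    qed
    define \<Psi> where "\<Psi> = (\<lambda>x. Re (L x) + \<kappa> ((cmod (f x))\<^sup>2) + \<kappa> ((cmod (g x))\<^sup>2) + ln (r\<^sup>2 - (cmod x)\<^sup>2))"
    have lap: "has_laplacian \<Psi> (0 + l1 + l2 + (- 4 * r\<^sup>2 / (r\<^sup>2 - (cmod x)\<^sup>2)\<^sup>2)) x"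
      unfolding \<Psi>_def
      by (intro has_laplacian_add has_laplacian_Re[OF L(1) S] l1 l2 l3)
    have \<Psi>: "\<Psi> y = ln (M y) \<and> M y > 0" if "y \<in> ball x d" for y
    proof -
      have y: "cmod y < r" "W y \<noteq> 0" using d(2)[OF that] by auto
      then have "(cmod y)\<^sup>2 < r\<^sup>2" by (simp add: power_strict_mono)
      moreover have "ln (cmod (W y)) = Re (L y)" using L(2)[OF that] by simp
      moreover have "M y = cmod (W y) * (1 + \<mu> f y) * (1 + \<mu> g y) * (r\<^sup>2 - (cmod y)\<^sup>2)"
        by (simp add: M_def \<Lambda>_def)
      ultimately show ?thesis
        unfolding \<Psi>_def \<kappa>_def using y(2) \<mu>_pos[of f y] \<mu>_pos[of g y]
        by (simp add: ln_mult_pos \<mu>_def)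
    qed
    have "\<forall>\<^sub>F y in nhds x. y \<in> ball x d" by (rule eventually_nhds_in_open[OF S])
    then have "\<forall>\<^sub>F y in nhds x. \<Psi> y \<le> \<Psi> x"
    proof eventually_elim
      case (elim y)
      have "M y \<le> M x" using d(2)[OF elim] by (intro x(2)) auto
      then show ?case using \<Psi>[OF elim] \<Psi>[OF S(2)] by simp
    qed
    from laplacian_nonpos_at_max[OF lap this]
    have l12: "l1 + l2 \<le> 4 * r\<^sup>2 / (r\<^sup>2 - (cmod x)\<^sup>2)\<^sup>2" by simp
    let ?s = "(cmod (deriv f x))\<^sup>2 * (1 + (cmod (f x))\<^sup>2) powr (- 1 - \<epsilon>) +
           (cmod (deriv g x))\<^sup>2 * (1 + (cmod (g x))\<^sup>2) powr (- 1 - \<epsilon>)"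
    have "\<epsilon>\<^sup>2 * ?s \<le> l1 + l2" using l1(2) l2(2) by (simp add: algebra_simps)
    then have s: "?s \<le> 4 * r\<^sup>2 / (r\<^sup>2 - (cmod x)\<^sup>2)\<^sup>2 / \<epsilon>\<^sup>2"
      using order_trans[OF _ l12] \<epsilon>(1) by (subst pos_le_divide_eq) (auto simp: mult.commute)
    have "(\<Lambda> x)\<^sup>2 \<le> K * ?s" unfolding \<Lambda>_def by (rule bound)
    also have "\<dots> \<le> \<bar>K\<bar> * ?s" by (intro mult_right_mono add_nonneg_nonneg) auto
    also have "\<dots> \<le> \<bar>K\<bar> * (4 * r\<^sup>2 / (r\<^sup>2 - (cmod x)\<^sup>2)\<^sup>2 / \<epsilon>\<^sup>2)"
      by (rule mult_left_mono[OF s]) simp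
    also have "\<dots> = K' * r\<^sup>2 / (r\<^sup>2 - (cmod x)\<^sup>2)\<^sup>2" by (simp add: K'_def mult_ac)
    finally have "(\<Lambda> x)\<^sup>2 * (r\<^sup>2 - (cmod x)\<^sup>2)\<^sup>2 \<le> K' * r\<^sup>2"
      using xr(2) by (simp add: pos_le_divide_eq)
    then have "(M x)\<^sup>2 \<le> K' * r\<^sup>2" by (simp add: M_def power_mult_distrib)
    moreover have "(M z)\<^sup>2 \<le> (M x)\<^sup>2" using Mz \<open>M z > 0\<close> by (intro power_mono) auto
    ultimately show ?thesis unfolding M_def by linarith
  qed
  \<comment> \<open>The first two summands give r^2 - |z|^2 \<ge> r^2 / 2, so that
    \<open>main\<close> yields (r \<Lambda>(z))^2 \<le> 4 K'. The last one makes r \<Lambda>(z)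
    exceed 2 K' + 1, whose square is larger than 4 K'.\<close>
  define r where "r = 2 * cmod z + 2 + 2 * (K' + 1) / \<Lambda> z"
  have r: "r \<ge> 2 * cmod z + 2" "r * \<Lambda> z > 2 * K' + 1"
    using \<open>\<Lambda> z > 0\<close> K' by (auto simp: r_def field_simps intro: add_pos_nonneg add_nonneg_pos)
  have rz: "r > cmod z" "r > 1" using r norm_ge_zero[of z] by linarith+
  have "(2 * cmod z)\<^sup>2 \<le> r\<^sup>2" using r by (intro power_mono) auto
  then have "4 * (cmod z)\<^sup>2 \<le> r\<^sup>2" by (simp add: power_mult_distrib)
  then have "r\<^sup>2 / 2 \<le> r\<^sup>2 - (cmod z)\<^sup>2"
    using zero_le_power2[of "cmod z"] by linarith
  then have "\<Lambda> z * (r\<^sup>2 / 2) \<le> \<Lambda> z * (r\<^sup>2 - (cmod z)\<^sup>2)" using \<open>\<Lambda> z > 0\<close> by (intro mult_left_mono) auto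
  then have "(\<Lambda> z * (r\<^sup>2 / 2))\<^sup>2 \<le> (\<Lambda> z * (r\<^sup>2 - (cmod z)\<^sup>2))\<^sup>2"
    using \<open>\<Lambda> z > 0\<close> by (intro power_mono) auto
  with main[OF rz(1)] have "(\<Lambda> z * (r\<^sup>2 / 2))\<^sup>2 \<le> K' * r\<^sup>2" by linarith
  then have "(r * \<Lambda> z)\<^sup>2 * r\<^sup>2 \<le> (4 * K') * r\<^sup>2" by (simp add: power2_eq_square field_simps)
  then have "(r * \<Lambda> z)\<^sup>2 \<le> 4 * K'" using rz by simp
  moreover have "(2 * K' + 1)\<^sup>2 \<le> (r * \<Lambda> z)\<^sup>2" using r K' by (intro power_mono) auto
  moreover have "(2 * K' + 1)\<^sup>2 = 4 * K' * K' + 4 * K' + 1" by (simp add: power2_eq_square algebra_simps)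
  ultimately show False using K' mult_nonneg_nonneg[OF K' K'] by linarith
qed

section \<open>Polynomials\<close>

text \<open>A stand-in for |x| that is never below 1, so it can be raised to negative and real
  exponents everywhere. Its square is the base of the powers in
  \<open>ahlfors_schwarz\<close>.\<close>

definition wt :: "complex \<Rightarrow> real" where
  "wt x = sqrt (1 + (cmod x)\<^sup>2)"

lemma wt_ge_1: "wt x \<ge> 1"
  by (simp add: wt_def)

lemma wt_pos [simp]: "wt x > 0"
  using wt_ge_1[of x] by linarith

lemma cmod_le_wt: "cmod x \<le> wt x"
  unfolding wt_def by (rule real_le_rsqrt) simp

lemma wt_le:
  assumes "cmod x \<le> r"
  shows "wt x \<le> 1 + r"
proof -
  have r: "0 \<le> r" using assms norm_ge_zero order_trans by blast
  have "(cmod x)\<^sup>2 \<le> r\<^sup>2" using assms by (intro power_mono) auto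
  moreover have "(1 + r)\<^sup>2 = 1 + r\<^sup>2 + 2 * r" by (simp add: power2_sum)
  ultimately have "1 + (cmod x)\<^sup>2 \<le> (1 + r)\<^sup>2" using r by linarith
  then show ?thesis unfolding wt_def using r by (intro real_le_lsqrt) auto
qed

lemma poly_le_wt: 
  assumes "degree P \<le> m"
  obtains c where "c > 0" "\<And>x. cmod (poly P x) \<le> c * wt x ^ m"
proof -
  have "\<exists>c\<ge>0. \<forall>x. cmod (poly P x) \<le> c * wt x ^ degree P"
  proof (induction P)
    case 0
    show ?case by (intro exI[of _ 0]) simp
  next
    case (pCons a P)
    then obtain c where c: "c \<ge> 0" "\<And>x. cmod (poly P x) \<le> c * wt x ^ degree P" by blast
    show ?case
    proof (cases "P = 0")
      case True
      then show ?thesis by (intro exI[of _ "cmod a"]) simp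
    next
      case False
      show ?thesis
      proof (intro exI[of _ "cmod a + c"] conjI allI)
        fix x
        have "cmod (poly (pCons a P) x) \<le> cmod a + cmod x * cmod (poly P x)"
          by (simp add: norm_mult norm_triangle_le)
        also have "cmod a \<le> cmod a * wt x ^ Suc (degree P)"
          using one_le_power[OF wt_ge_1[of x]] mult_left_mono[of 1 _ "cmod a"] by (simp del: power_Suc)
        also have "cmod x * cmod (poly P x) \<le> wt x * (c * wt x ^ degree P)"
          using c(2)[of x] cmod_le_wt[of x] by (intro mult_mono) (auto intro: less_imp_le)
        finally show "cmod (poly (pCons a P) x) \<le> (cmod a + c) * wt x ^ degree (pCons a P)"
          using False by (simp add: algebra_simps)
      qed (use c in auto)
    qed
  qed
  then obtain c where c: "c \<ge> 0" "\<And>x. cmod (poly P x) \<le> c * wt x ^ degree P" by blast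
  show ?thesis
  proof (rule that[of "c + 1"])
    fix x
    have "c * wt x ^ degree P \<le> (c + 1) * wt x ^ m"
      using c assms wt_ge_1[of x] by (intro mult_mono power_increasing) auto
    with c show "cmod (poly P x) \<le> (c + 1) * wt x ^ m" using order_trans by blast
  qed (use c in auto)
qed

lemma poly_ge_wt:
  assumes "P \<noteq> (0 :: complex poly)"
  obtains c r where "c > 0" "r > 0" "\<And>x. cmod x \<ge> r \<Longrightarrow> cmod (poly P x) \<ge> c * wt x ^ degree P"
proof -
  have "\<exists>c>0. \<exists>r\<ge>1. \<forall>x. cmod x \<ge> r \<longrightarrow> cmod (poly P x) \<ge> c * cmod x ^ degree P"
    using assms
  proof (induction P)
    case (pCons a P)
    show ?case
    proof (cases "P = 0")
      case True
      then show ?thesis using pCons by (intro exI[of _ "cmod a"]) auto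
    next
      case False
      then obtain c r where c: "c > 0" "r \<ge> 1" "\<And>x. cmod x \<ge> r \<Longrightarrow> cmod (poly P x) \<ge> c * cmod x ^ degree P"
        using pCons by blast
      \<comment> \<open>Beyond this radius the constant term a is at most half of the bound for x
        P(x), so half of that bound survives.\<close>
      define r' where "r' = max r (2 * cmod a / c)"
      show ?thesis
      proof (rule exI[of _ "c / 2"], intro conjI exI[of _ r'] allI impI)
        fix x assume x: "r' \<le> cmod x"
        have x1: "cmod x \<ge> 1" "cmod x \<ge> r" using c(2) x by (auto simp: r'_def)
        have "2 * cmod a \<le> c * cmod x" using x c(1) by (simp add: r'_def pos_divide_le_eq mult.commute)
        also have "\<dots> \<le> c * cmod x ^ Suc (degree P)"
          using c(1) x1 by (intro mult_left_mono self_le_power) auto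
        finally have "2 * cmod a \<le> c * cmod x ^ Suc (degree P)" .
        moreover have "cmod x * (c * cmod x ^ degree P) = c * cmod x ^ Suc (degree P)" by simp
        ultimately have "c / 2 * cmod x ^ Suc (degree P) \<le> cmod x * (c * cmod x ^ degree P) - cmod a"
          by linarith
        also have "\<dots> \<le> cmod x * cmod (poly P x) - cmod a"
          using c(3)[OF x1(2)] by (intro diff_right_mono mult_left_mono) auto
        also have "\<dots> \<le> cmod (poly (pCons a P) x)"
          using norm_triangle_ineq2[of "x * poly P x" "- a"] by (simp add: norm_mult add.commute)
        finally show "c / 2 * cmod x ^ degree (pCons a P) \<le> cmod (poly (pCons a P) x)"
          using False by simp
      qed (use c(1,2) in \<open>auto simp: r'_def\<close>)
    qed
  qed simp
  then obtain c r where c: "c > 0" "r \<ge> 1" "\<And>x. cmod x \<ge> r \<Longrightarrow> cmod (poly P x) \<ge> c * cmod x ^ degree P"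
    by blast
  show ?thesis
  \<comment> \<open>For |x| \<ge> 1 one has wt x \<le> 2 |x|; this costs the power of 2.\<close>
  proof (rule that[of "c / 2 ^ degree P" r])
    fix x assume x: "r \<le> cmod x"
    have "wt x \<le> 2 * cmod x" using wt_le[of x "cmod x"] x c(2) by linarith
    then have "wt x ^ degree P \<le> (2 * cmod x) ^ degree P"
      by (intro power_mono) (auto intro: less_imp_le)
    then have "c / 2 ^ degree P * wt x ^ degree P \<le> c / 2 ^ degree P * (2 * cmod x) ^ degree P"
      using c(1) by (intro mult_left_mono) auto
    also have "\<dots> = c * cmod x ^ degree P" by (simp add: power_mult_distrib)
    also have "\<dots> \<le> cmod (poly P x)" using c(3)[OF x] by simp
    finally show "c / 2 ^ degree P * wt x ^ degree P \<le> cmod (poly P x)" .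
  qed (use c(1,2) in auto)
qed

text \<open>Outside a disc the polynomial of maximal degree dominates. Inside, the sum of the moduli
  has a positive minimum, because coprime polynomials have no common zero.\<close>

lemma coprime_pair_ge_wt:
  fixes A B :: "complex poly"
  assumes "coprime A B"
  obtains c where "c > 0"
    "\<And>x. c * wt x ^ max (degree A) (degree B) \<le> cmod (poly A x) + cmod (poly B x)"
proof -
  define m where "m = max (degree A) (degree B)"
  obtain c r where c: "c > 0" "r > 0" "\<And>x. cmod x \<ge> r \<Longrightarrow> c * wt x ^ m \<le> cmod (poly A x) + cmod (poly B x)"
  proof (cases "m = 0")
    \<comment> \<open>For m = 0 the polynomial that attains the maximal degree may be 0, so
      \<open>poly_ge_wt\<close> might not apply to it; coprimality makes one of the two constants
      nonzero.\<close>
    case True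
    then obtain a b where ab: "A = [:a:]" "B = [:b:]"
      unfolding m_def by (metis degree_eq_zeroE le_zero_eq max.cobounded1 max.cobounded2)
    then have "a \<noteq> 0 \<or> b \<noteq> 0" using coprime_poly_0[OF assms, of 0] by simp
    then have "cmod a + cmod b > 0" by (metis add_pos_nonneg add_nonneg_pos norm_ge_zero zero_less_norm_iff)
    then show ?thesis using that[of "cmod a + cmod b" 1] ab True by simp
  next
    case False
    then consider "degree A = m" "A \<noteq> 0" | "degree B = m" "B \<noteq> 0"
      unfolding m_def by (metis degree_0 max_def)
    then show ?thesis
    proof cases
      case 1
      obtain c r where "c > 0" "r > 0" "\<And>x. cmod x \<ge> r \<Longrightarrow> cmod (poly A x) \<ge> c * wt x ^ degree A"
        using poly_ge_wt[OF 1(2)] by blast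
      then show ?thesis using that[of c r] 1 by (metis add_increasing2 norm_ge_zero)
    next
      case 2
      obtain c r where "c > 0" "r > 0" "\<And>x. cmod x \<ge> r \<Longrightarrow> cmod (poly B x) \<ge> c * wt x ^ degree B"
        using poly_ge_wt[OF 2(2)] by blast
      then show ?thesis using that[of c r] 2 by (metis add_increasing norm_ge_zero)
    qed
  qed
  let ?s = "\<lambda>x. cmod (poly A x) + cmod (poly B x)"
  have "continuous_on (cball 0 r) ?s" by (intro continuous_intros)
  moreover have "cball 0 r \<noteq> ({}::complex set)" using c(2) by auto
  ultimately obtain x0 where x0: "\<And>y. y \<in> cball 0 r \<Longrightarrow> ?s x0 \<le> ?s y"
    using continuous_attains_inf[OF compact_cball, of 0 r ?s] by blast
  have s0: "?s x0 > 0"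
    using coprime_poly_0[OF assms, of x0] by (auto intro: add_pos_nonneg add_nonneg_pos)
  define c' where "c' = min c (?s x0 / (1 + r) ^ m)"
  show ?thesis
  proof (rule that[of c'])
    show "c' > 0" unfolding c'_def using c(1,2) s0 by simp
    fix x
    show "c' * wt x ^ max (degree A) (degree B) \<le> ?s x"
    proof (cases "cmod x \<ge> r")
      case True
      have "c' * wt x ^ m \<le> c * wt x ^ m" unfolding c'_def by (intro mult_right_mono) (auto intro: less_imp_le)
      then show ?thesis using order_trans[OF _ c(3)[OF True]] by (simp add: m_def)
    next
      case False
      have "c' * wt x ^ m \<le> (?s x0 / (1 + r) ^ m) * (1 + r) ^ m"
        using c(1,2) s0 False wt_le[of x r] unfolding c'_def
        by (intro mult_mono power_mono) (auto intro: less_imp_le)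
      also have "\<dots> = ?s x0" using c(2) by simp
      also have "\<dots> \<le> ?s x" using False by (intro x0) simp
      finally show ?thesis by (simp add: m_def)
    qed
  qed
qed

section \<open>Coprimality and radicals of complex polynomials\<close>

lemma coprime_complex_polyI:
  fixes P Q :: "complex poly"
  assumes "\<And>x. poly P x = 0 \<Longrightarrow> poly Q x \<noteq> 0"
  shows "coprime P Q"
proof (rule coprimeI)
  fix e assume e: "e dvd P" "e dvd Q"
  show "is_unit e"
  proof (rule ccontr)
    assume nonunit: "\<not> is_unit e"
    have "\<not> constant (poly e)"
    proof
      assume "constant (poly e)"
      then obtain k where k: "e = [:k:]"
        using constant_degree[of e] by (metis degree_eq_zeroE)
      with nonunit have "e = 0" using is_unit_triv[of k] by auto
      with e have "P = 0" "Q = 0" by auto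
      then show False using assms[of 0] by simp
    qed
    then obtain x where "poly e x = 0" using fundamental_theorem_of_algebra by blast
    then show False using assms[of x] e by (auto elim!: dvdE)
  qed
qed

lemma complex_poly_bezout:
  fixes P Q :: "complex poly"
  assumes "coprime P Q"
  obtains a b where "a * P + b * Q = 1"
  using that bezout_coefficients_fst_snd[of P Q] coprime_imp_gcd_eq_1[OF assms] by simp

lemma prod_dvd_of_pairwise_coprime:
  fixes P :: "'i \<Rightarrow> 'a :: semiring_gcd"
  assumes "finite I" "\<And>i j. i \<in> I \<Longrightarrow> j \<in> I \<Longrightarrow> i \<noteq> j \<Longrightarrow> coprime (P i) (P j)"
    "\<And>i. i \<in> I \<Longrightarrow> P i dvd N"
  shows "(\<Prod>i\<in>I. P i) dvd N"
  using assms
proof (induction I rule: finite_induct)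
  case (insert x I)
  have "coprime (P x) (\<Prod>i\<in>I. P i)"
    using insert by (intro prod_coprime_right) auto
  then show ?case using insert by (simp add: divides_mult)
qed simp

text \<open>R is P / gcd(P, P'), the radical of P. A common root of P and P' makes the gcd
  nonconstant, which gives the drop in degree. That P divides R P' expresses algebraically that R P'
  / P has no poles, in a form that survives taking products.\<close>

lemma radical_divisor:
  fixes P :: "complex poly"
  assumes P: "P \<noteq> 0" and c: "poly P c = 0" "poly (pderiv P) c = 0"
  obtains R where "R dvd P" "degree R + 1 \<le> degree P" "P dvd R * pderiv P"
proof -
  define d where "d = gcd P (pderiv P)"
  obtain R where R: "P = d * R" using gcd_dvd1 unfolding d_def by (metis dvdE)
  obtain e where e: "pderiv P = d * e" using gcd_dvd2 unfolding d_def by (metis dvdE)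
  have "[:- c, 1:] dvd d" unfolding d_def using c by (simp add: poly_eq_0_iff_dvd)
  then have "poly d c = 0" by (simp add: poly_eq_0_iff_dvd)
  moreover have nz: "d \<noteq> 0" "R \<noteq> 0" using R P by auto
  ultimately have "degree d > 0" by (auto elim!: degree_eq_zeroE intro!: gr0I)
  then have "degree R + 1 \<le> degree P" using nz by (simp add: R degree_mult_eq)
  moreover have "P dvd R * pderiv P" unfolding e by (subst R) (simp add: mult.assoc mult.left_commute)
  ultimately show ?thesis using that[of R] R by simp
qed

section \<open>Bounding the pseudometric\<close>

text \<open>To be read with X, Y the sizes of f and g, u = |exp h|, v = |V|, g1 = |g'|. As s \<le>
  0, the lower bound X^p / (c2 Y^q) for u becomes an upper bound for its s-th power; the conditions
  on s then collect the exponents of X and of Y, weights included.\<close>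

lemma growth_weight_bound_outer:
  fixes X Y u v g1 \<epsilon> s :: real and p q n m :: nat
  assumes XY: "X \<ge> 1" "Y \<ge> 1" and u: "u > 0" and g1: "g1 \<ge> 0" and c: "c > 0" "c2 > 0"
    and s: "s \<le> 0" "real m + p * s + 2 * \<epsilon> = 0" "- real n - q * s + 2 * \<epsilon> \<le> - 1 - \<epsilon>"
    and X: "X ^ p \<le> c2 * u * Y ^ q" and v: "v \<le> c * X ^ m * g1 / Y ^ n"
  shows "v * u powr s * X powr (2 * \<epsilon>) * Y powr (2 * \<epsilon>) \<le> c * c2 powr (- s) * (g1 * Y powr (- 1 - \<epsilon>))"
proof -
  have pos: "X > 0" "Y > 0" using XY by auto
  have "X ^ p / (c2 * Y ^ q) \<le> u"
    using X c pos by (simp add: pos_divide_le_eq mult_ac)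
  then have "u powr s \<le> (X ^ p / (c2 * Y ^ q)) powr s"
    using s c pos by (intro powr_mono2') auto
  also have "\<dots> = c2 powr (- s) * X powr (p * s) * Y powr (- q * s)"
    using pos c by (simp add: powr_divide powr_mult powr_powr powr_minus field_simps flip: powr_realpow)
  finally have us: "u powr s \<le> c2 powr (- s) * X powr (p * s) * Y powr (- q * s)" .
  have "v * u powr s \<le> (c * X ^ m * g1 / Y ^ n) * (c2 powr (- s) * X powr (p * s) * Y powr (- q * s))"
    using v us u c pos g1 by (intro mult_mono) auto
  then have "v * u powr s * (X powr (2 * \<epsilon>) * Y powr (2 * \<epsilon>)) \<le>
    (c * X ^ m * g1 / Y ^ n) * (c2 powr (- s) * X powr (p * s) * Y powr (- q * s)) * (X powr (2 * \<epsilon>) * Y powr (2 * \<epsilon>))"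
    by (rule mult_right_mono) simp
  also have "\<dots> = c * c2 powr (- s) * g1 * (X powr m * X powr (p * s) * X powr (2 * \<epsilon>)) *
      (Y powr (- n) * Y powr (- q * s) * Y powr (2 * \<epsilon>))"
    using pos by (simp add: powr_minus_divide powr_realpow mult_ac)
  also have "\<dots> = c * c2 powr (- s) * g1 * X powr (real m + p * s + 2 * \<epsilon>) * Y powr (- real n - q * s + 2 * \<epsilon>)"
    by (simp flip: powr_add)
  also have "\<dots> \<le> c * c2 powr (- s) * g1 * X powr (real m + p * s + 2 * \<epsilon>) * Y powr (- 1 - \<epsilon>)"
    using s(3) XY c g1 by (intro mult_left_mono powr_mono) auto
  finally show ?thesis using pos unfolding s(2) by (simp add: mult_ac)
qed

text \<open>Here v carries the factor u^k, so u occurs with the total exponent k + s \<ge> 0 and its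
  upper bound is the relevant one. The powers of X cancel again, and those of Y only cost constants
  since Y \<le> N.\<close>

lemma growth_weight_bound_inner:
  fixes X Y u v g1 \<epsilon> s N :: real and p q k :: nat
  assumes XY: "X \<ge> 1" "Y \<ge> 1" "Y \<le> N" and u: "u > 0" and g1: "g1 \<ge> 0" and c: "c > 0" "c1 > 0" and \<epsilon>: "\<epsilon> \<ge> 0"
    and s: "k + s \<ge> 0" "p * (k + s) = k - 2 * \<epsilon>"
    and X: "c1 * u * Y ^ q \<le> X ^ p" and v: "v \<le> c * g1 * u ^ k / X ^ k"
  shows "v * u powr s * X powr (2 * \<epsilon>) * Y powr (2 * \<epsilon>) \<le>
    c * c1 powr (- (k + s)) * N powr (2 * \<epsilon>) * N powr (1 + \<epsilon>) * (g1 * Y powr (- 1 - \<epsilon>))"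
proof -
  have pos: "X > 0" "Y > 0" "N > 0" using XY by auto
  have "c1 * u \<le> c1 * u * Y ^ q" using c u XY by simp
  then have "u \<le> X ^ p / c1"
    using order_trans[OF _ X] c by (simp add: pos_le_divide_eq mult.commute)
  then have "u powr (k + s) \<le> (X ^ p / c1) powr (k + s)"
    using s c pos u by (intro powr_mono2) auto
  also have "\<dots> = c1 powr (- (k + s)) * X powr (k - 2 * \<epsilon>)"
    unfolding s(2)[symmetric] using pos c by (simp add: powr_divide powr_powr powr_minus_divide mult.commute del: minus_add_distrib flip: powr_realpow)
  finally have us: "u powr (k + s) \<le> c1 powr (- (k + s)) * X powr (k - 2 * \<epsilon>)" .
  have "v * u powr s * X powr (2 * \<epsilon>) \<le> (c * g1 * u ^ k / X ^ k) * u powr s * X powr (2 * \<epsilon>)"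
    using v by (intro mult_right_mono) auto
  also have "\<dots> = c * g1 * u powr (k + s) * X powr (2 * \<epsilon> - k)"
    using pos u by (simp add: powr_add powr_diff powr_realpow)
  also have "\<dots> \<le> c * g1 * (c1 powr (- (k + s)) * X powr (k - 2 * \<epsilon>)) * X powr (2 * \<epsilon> - k)"
    using us c g1 by (intro mult_left_mono mult_right_mono) auto
  also have "\<dots> = c * g1 * c1 powr (- (k + s)) * X powr ((k - 2 * \<epsilon>) + (2 * \<epsilon> - k))"
    unfolding powr_add by simp
  also have "\<dots> = c * c1 powr (- (k + s)) * g1" using pos by simp
  finally have 1: "v * u powr s * X powr (2 * \<epsilon>) \<le> c * c1 powr (- (k + s)) * g1" .
  have Y1: "Y powr (2 * \<epsilon>) \<le> N powr (2 * \<epsilon>)" using XY \<epsilon> by (intro powr_mono2) auto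
  have Y2: "1 \<le> N powr (1 + \<epsilon>) * Y powr (- 1 - \<epsilon>)"
  proof -
    have "Y powr (1 + \<epsilon>) * Y powr (- 1 - \<epsilon>) \<le> N powr (1 + \<epsilon>) * Y powr (- 1 - \<epsilon>)"
      using XY \<epsilon> by (intro mult_right_mono powr_mono2) auto
    then show ?thesis using pos by (simp flip: powr_add)
  qed
  have "v * u powr s * X powr (2 * \<epsilon>) * Y powr (2 * \<epsilon>) \<le> c * c1 powr (- (k + s)) * g1 * N powr (2 * \<epsilon>)"
    by (rule mult_mono[OF 1 Y1]) (use c g1 in auto)
  also have "\<dots> \<le> c * c1 powr (- (k + s)) * g1 * N powr (2 * \<epsilon>) * (N powr (1 + \<epsilon>) * Y powr (- 1 - \<epsilon>))"
    using mult_left_mono[OF Y2, of "c * c1 powr (- (k + s)) * g1 * N powr (2 * \<epsilon>)"] c g1 by simp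
  finally show ?thesis by (simp add: mult_ac)
qed

text \<open>X and Y range over bounded intervals, and s \<le> 0 makes the lower bound for u
  sufficient, so every power is bounded by a constant. Both f1 and g1 appear because the pole-free
  formula for V contains both derivatives.\<close>

lemma growth_weight_bound_compact:
  fixes X Y u v f1 g1 \<epsilon> s M N l :: real
  assumes XY: "X \<ge> 1" "X \<le> M" "Y \<ge> 1" "Y \<le> N" and u: "l > 0" "u \<ge> l" and g1: "f1 \<ge> 0" "g1 \<ge> 0"
    and c: "c > 0" and \<epsilon>: "\<epsilon> \<ge> 0" and s: "s \<le> 0" and v: "v \<le> c * (f1 + g1)"
  shows "v * u powr s * X powr (2 * \<epsilon>) * Y powr (2 * \<epsilon>) \<le>
    c * l powr s * M powr (2 * \<epsilon>) * N powr (2 * \<epsilon>) * (M powr (1 + \<epsilon>) + N powr (1 + \<epsilon>)) *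
      (f1 * X powr (- 1 - \<epsilon>) + g1 * Y powr (- 1 - \<epsilon>))"
proof -
  have one: "1 \<le> B powr (1 + \<epsilon>) * A powr (- 1 - \<epsilon>)" if "A \<ge> 1" "A \<le> B" for A B :: real
  proof -
    have "A powr (1 + \<epsilon>) * A powr (- 1 - \<epsilon>) \<le> B powr (1 + \<epsilon>) * A powr (- 1 - \<epsilon>)"
      using that \<epsilon> by (intro mult_right_mono powr_mono2) auto
    then show ?thesis using that by (simp flip: powr_add)
  qed
  let ?S = "M powr (1 + \<epsilon>) + N powr (1 + \<epsilon>)"
  have "1 \<le> ?S * X powr (- 1 - \<epsilon>)" "1 \<le> ?S * Y powr (- 1 - \<epsilon>)"
    using one[OF XY(1,2)] one[OF XY(3,4)] by (auto simp: distrib_right intro: add_increasing add_increasing2)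
  from mult_left_mono[OF this(1) g1(1)] mult_left_mono[OF this(2) g1(2)]
  have fg: "f1 + g1 \<le> ?S * (f1 * X powr (- 1 - \<epsilon>) + g1 * Y powr (- 1 - \<epsilon>))"
    by (simp add: algebra_simps)
  have "v * u powr s * X powr (2 * \<epsilon>) * Y powr (2 * \<epsilon>) \<le>
    c * (f1 + g1) * l powr s * M powr (2 * \<epsilon>) * N powr (2 * \<epsilon>)"
    using XY u g1 c \<epsilon> s v by (intro mult_mono powr_mono2 powr_mono2') auto
  also have "\<dots> = c * l powr s * M powr (2 * \<epsilon>) * N powr (2 * \<epsilon>) * (f1 + g1)" by (simp add: mult_ac)
  also have "\<dots> \<le> c * l powr s * M powr (2 * \<epsilon>) * N powr (2 * \<epsilon>) *
      (?S * (f1 * X powr (- 1 - \<epsilon>) + g1 * Y powr (- 1 - \<epsilon>)))"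
    using fg c by (intro mult_left_mono) auto
  finally show ?thesis by (simp add: mult_ac)
qed


lemma wt_powr: "(1 + (cmod x)\<^sup>2) powr e = wt x powr (2 * e)"
proof -
  have "1 + (cmod x)\<^sup>2 = wt x powr 2" by (simp add: wt_def add_nonneg_nonneg)
  then show ?thesis by (simp add: powr_powr)
qed

text \<open>
  The exponent \<open>s\<close> in the proof is chosen such that the powers of \<open>|f|\<close> cancel where \<open>g\<close> is large;
  there the hypothesis \<open>p < k * q\<close> yields the surplus decay in \<open>|g|\<close>. Where \<open>g\<close> is bounded and
  \<open>f\<close> is large, \<open>E (g) = P (f) / U^k\<close> and the degree drop of \<open>R\<close> against \<open>P\<close> takes over. Where both
  are bounded, the second formula for \<open>V\<close>, which has no denominator \<open>E (g)\<close>, is used.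
\<close>
lemma entire_form_vanishes:
  fixes f g h V :: "complex \<Rightarrow> complex" and P E R a b T :: "complex poly" and p q k :: nat
  assumes hol: "f holomorphic_on UNIV" "g holomorphic_on UNIV" "h holomorphic_on UNIV" "V holomorphic_on UNIV"
    and pq: "0 < p" "p < k * q"
    and c1: "c1 > 0" "\<And>z. c1 * cmod (exp (h z)) * wt (g z) ^ q \<le> wt (f z) ^ p"
    and c2: "c2 > 0" "\<And>z. wt (f z) ^ p \<le> c2 * cmod (exp (h z)) * wt (g z) ^ q"
    and PE: "\<And>z. poly P (f z) = exp (h z) ^ k * poly E (g z)"
    and EV: "\<And>z. poly E (g z) * V z = poly R (f z) * deriv g z"
    and V: "\<And>z. V z = poly a (g z) * poly R (f z) * deriv g z +
      poly b (g z) * (exp (h z) ^ k / exp (h z) ^ 2) * poly T (f z) * deriv f z"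
    and deg: "degree E = k * q" "degree R + k \<le> degree P" "degree P \<le> k * p"
    and nz: "P \<noteq> 0" "E \<noteq> 0"
  shows "V z = 0"
proof -
  \<comment> \<open>m bounds the degree of R: it is at most deg P - k, hence at most k p -
    k.\<close>
  define n m where "n = k * q" and "m = k * (p - 1)"
  have k: "k > 0" using pq by (cases k) auto
  define \<delta> where "\<delta> = real n / p - 1"
  have \<delta>: "\<delta> > 0" using pq unfolding \<delta>_def n_def by (simp del: of_nat_mult)
  \<comment> \<open>\<delta> is the surplus that has to pay for 2 \<epsilon> from the weight in g,
    \<epsilon> from the target exponent - 1 - \<epsilon>, and 2 \<epsilon> q / p from the shift in
    s. The cap 1/4 keeps k - 2 \<epsilon> nonnegative and \<epsilon> below 1.\<close>
  define \<epsilon> where "\<epsilon> = min (1/4) (\<delta> / (3 + 2 * q / p))"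
  have \<epsilon>: "0 < \<epsilon>" "\<epsilon> \<le> 1 / 4"
  proof -
    show "0 < \<epsilon>" unfolding \<epsilon>_def using \<delta> by (auto intro!: divide_pos_pos add_pos_nonneg)
    show "\<epsilon> \<le> 1 / 4" unfolding \<epsilon>_def by (rule min.cobounded1)
  qed
  have "\<epsilon> \<le> \<delta> / (3 + 2 * q / p)" by (simp add: \<epsilon>_def)
  then have \<epsilon>\<delta>: "\<epsilon> * (3 + 2 * q / p) \<le> \<delta>"
    by (subst (asm) pos_le_divide_eq) (auto intro: add_pos_nonneg)
  define s where "s = - (m + 2 * \<epsilon>) / real p"
  have m: "real m = real k * real p - real k" using pq(1) by (simp add: m_def of_nat_diff algebra_simps)
  have ps: "p * s = - (m + 2 * \<epsilon>)" using pq(1) by (simp add: s_def)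
  have s0: "s \<le> 0" unfolding s_def using \<epsilon> pq(1) by (intro divide_nonpos_pos) auto
  have s1: "real m + p * s + 2 * \<epsilon> = 0" using ps by simp
  have s2: "- real n - q * s + 2 * \<epsilon> \<le> - 1 - \<epsilon>"
  proof -
    have "q * s = - (n - n / real p + 2 * \<epsilon> * q / p)"
      using pq(1) unfolding s_def m n_def by (simp add: field_simps)
    then show ?thesis using \<epsilon>\<delta> unfolding \<delta>_def by (simp add: algebra_simps)
  qed
  \<comment> \<open>Since m = k p - k, this is the equation \<open>s1\<close> rewritten: one
    exponent s cancels the powers of f in both regions.\<close>
  have s3: "p * (k + s) = k - 2 * \<epsilon>" using ps m by (simp add: algebra_simps)
  have s4: "k + s \<ge> 0"
  proof -
    have "k - 2 * \<epsilon> \<ge> 0" using k \<epsilon> by (simp add: order_trans[of _ 1])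
    then have "0 \<le> p * (k + s)" unfolding s3 .
    then show ?thesis using pq(1) by (simp add: zero_le_mult_iff)
  qed
  obtain cE N where cE: "cE > 0" "N > 0" "\<And>x. cmod x \<ge> N \<Longrightarrow> cE * wt x ^ n \<le> cmod (poly E x)"
    using poly_ge_wt[OF nz(2)] deg(1) unfolding n_def by metis
  obtain cP M where cP: "cP > 0" "M > 0" "\<And>x. cmod x \<ge> M \<Longrightarrow> cP * wt x ^ degree P \<le> cmod (poly P x)"
    using poly_ge_wt[OF nz(1)] by metis
  obtain cR where cR: "cR > 0" "\<And>x. cmod (poly R x) \<le> cR * wt x ^ degree R"
    using poly_le_wt[of R] by blast
  obtain cT where cT: "cT > 0" "\<And>x. cmod (poly T x) \<le> cT * wt x ^ degree T"
    using poly_le_wt[of T] by blast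
  obtain ca where ca: "ca > 0" "\<And>x. cmod (poly a x) \<le> ca * wt x ^ degree a"
    using poly_le_wt[of a] by blast
  obtain cb where cb: "cb > 0" "\<And>x. cmod (poly b x) \<le> cb * wt x ^ degree b"
    using poly_le_wt[of b] by blast
  define M' N' where "M' = 1 + M" and "N' = 1 + N"
  \<comment> \<open>Where f and g are bounded, the comparison of |f|^p with |exp h| |g|^q confines
    |exp h| to the interval from \<open>l\<close> to \<open>l'\<close>.\<close>
  define l l' where "l = 1 / (c2 * N' ^ q)" and "l' = M' ^ p / c1"
  define c where "c = ca * N' ^ degree a * (cR * M' ^ degree R) + cb * N' ^ degree b * (l' ^ k / l ^ 2) * (cT * M' ^ degree T)"
  have pos: "M' > 0" "N' > 0" "l > 0" "l' > 0" "c > 0"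
    using cP(2) cE(2) c1(1) c2(1) ca(1) cb(1) cR(1) cT(1) unfolding M'_def N'_def l_def l'_def c_def
    by (auto intro!: add_pos_pos mult_pos_pos divide_pos_pos zero_less_power)
  define K1 where "K1 = cR / cE * c2 powr (- s)"
  define K2 where "K2 = cR / cP * c1 powr (- (k + s)) * N' powr (2 * \<epsilon>) * N' powr (1 + \<epsilon>)"
  define K3 where "K3 = c * l powr s * M' powr (2 * \<epsilon>) * N' powr (2 * \<epsilon>) * (M' powr (1 + \<epsilon>) + N' powr (1 + \<epsilon>))"
  define K where "K = K1 + K2 + K3"
  have K: "0 \<le> K1" "0 \<le> K2" "0 \<le> K3" unfolding K1_def K2_def K3_def
    using cR(1) cE(1) cP(1) pos by auto
  let ?rhs = "\<lambda>z. cmod (deriv f z) * wt (f z) powr (- 1 - \<epsilon>) + cmod (deriv g z) * wt (g z) powr (- 1 - \<epsilon>)"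
  have main: "cmod (V z) * cmod (exp (h z)) powr s * wt (f z) powr (2 * \<epsilon>) * wt (g z) powr (2 * \<epsilon>) \<le> K * ?rhs z" for z
  proof -
    define X Y u where "X = wt (f z)" and "Y = wt (g z)" and "u = cmod (exp (h z))"
    have XY: "X \<ge> 1" "Y \<ge> 1" "X > 0" "Y > 0" by (simp_all add: X_def Y_def wt_ge_1)
    have u: "u > 0" by (simp add: u_def)
    have up: "X ^ p \<le> c2 * u * Y ^ q" and lo: "c1 * u * Y ^ q \<le> X ^ p"
      using c1(2) c2(2) by (simp_all add: X_def Y_def u_def)
    have EVn: "cmod (poly E (g z)) * cmod (V z) = cmod (poly R (f z)) * cmod (deriv g z)"
      using EV[of z] by (metis norm_mult)
    have PEn: "cmod (poly P (f z)) = u ^ k * cmod (poly E (g z))"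
      unfolding PE u_def by (simp add: norm_mult norm_power)
    have rhs: "0 \<le> ?rhs z" "cmod (deriv g z) * Y powr (- 1 - \<epsilon>) \<le> ?rhs z" by (simp_all add: Y_def)
    consider (outer) "cmod (g z) \<ge> N" | (inner) "cmod (g z) \<le> N" "cmod (f z) \<ge> M"
      | (cpt) "cmod (g z) \<le> N" "cmod (f z) \<le> M" by linarith
    then have "cmod (V z) * u powr s * X powr (2 * \<epsilon>) * Y powr (2 * \<epsilon>) \<le> K * ?rhs z"
    proof cases
      case outer
      have "cE * Y ^ n * cmod (V z) \<le> cmod (poly R (f z)) * cmod (deriv g z)"
        unfolding EVn[symmetric] using cE(3)[OF outer] by (intro mult_right_mono) (auto simp: Y_def)
      also have "\<dots> \<le> cR * X ^ degree R * cmod (deriv g z)"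
        using cR(2)[of "f z"] by (intro mult_right_mono) (auto simp: X_def)
      also have "\<dots> \<le> cR * X ^ m * cmod (deriv g z)"
      proof -
        have "degree R \<le> m" using deg(2,3) unfolding m_def by (simp add: diff_mult_distrib2)
        then show ?thesis using XY(1) cR(1) by (intro mult_right_mono mult_left_mono power_increasing) auto
      qed
      finally have "cmod (V z) \<le> cR / cE * X ^ m * cmod (deriv g z) / Y ^ n"
        using cE(1) XY by (simp add: pos_le_divide_eq mult_ac)
      from growth_weight_bound_outer[OF XY(1,2) u norm_ge_zero _ c2(1) s0 s1 s2 up this]
      have "cmod (V z) * u powr s * X powr (2 * \<epsilon>) * Y powr (2 * \<epsilon>) \<le> K1 * (cmod (deriv g z) * Y powr (- 1 - \<epsilon>))"
        unfolding K1_def using cR(1) cE(1) by simp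
      also have "\<dots> \<le> K * ?rhs z" using K rhs unfolding K_def by (intro mult_mono) auto
      finally show ?thesis .
    next
      case inner
      have YN: "Y \<le> N'" using wt_le[OF inner(1)] by (simp add: Y_def N'_def)
      have "cP * X ^ degree P * cmod (V z) \<le> u ^ k * cmod (poly E (g z)) * cmod (V z)"
        unfolding PEn[symmetric] using cP(3)[OF inner(2)] by (intro mult_right_mono) (auto simp: X_def)
      also have "\<dots> = u ^ k * (cmod (poly R (f z)) * cmod (deriv g z))"
        unfolding EVn[symmetric] by simp
      also have "\<dots> \<le> u ^ k * (cR * X ^ degree R * cmod (deriv g z))"
        using cR(2)[of "f z"] u by (intro mult_left_mono mult_right_mono) (auto simp: X_def)
      finally have 1: "cP * X ^ degree P * cmod (V z) \<le> u ^ k * (cR * X ^ degree R * cmod (deriv g z))" .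
      have "cP * (X ^ degree R * X ^ k) * cmod (V z) \<le> cP * X ^ degree P * cmod (V z)"
        using cP(1) XY(1) deg(2) unfolding power_add[symmetric]
        by (intro mult_right_mono mult_left_mono power_increasing) auto
      with 1 have "X ^ degree R * (cP * X ^ k * cmod (V z)) \<le> X ^ degree R * (u ^ k * cR * cmod (deriv g z))"
        by (simp add: mult_ac)
      then have "cP * X ^ k * cmod (V z) \<le> u ^ k * cR * cmod (deriv g z)" using XY by simp
      then have "cmod (V z) \<le> cR / cP * cmod (deriv g z) * u ^ k / X ^ k"
        using cP(1) XY by (simp add: pos_le_divide_eq mult_ac)
      from growth_weight_bound_inner[OF XY(1,2) YN u norm_ge_zero _ c1(1) _ s4 s3 lo this]
      have "cmod (V z) * u powr s * X powr (2 * \<epsilon>) * Y powr (2 * \<epsilon>) \<le> K2 * (cmod (deriv g z) * Y powr (- 1 - \<epsilon>))"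
        unfolding K2_def using cR(1) cP(1) \<epsilon>(1) by simp
      also have "\<dots> \<le> K * ?rhs z" using K rhs unfolding K_def by (intro mult_mono) auto
      finally show ?thesis .
    next
      case cpt
      have YN: "Y \<le> N'" and XM: "X \<le> M'"
        using wt_le[OF cpt(1)] wt_le[OF cpt(2)] by (simp_all add: X_def Y_def N'_def M'_def)
      have "1 \<le> X ^ p" using XY by simp
      also note up
      also have "c2 * u * Y ^ q \<le> c2 * u * N' ^ q" using YN XY c2(1) u by (intro mult_left_mono power_mono) auto
      finally have ul: "l \<le> u" unfolding l_def using c2(1) pos by (simp add: pos_divide_le_eq mult_ac)
      have "c1 * u \<le> c1 * u * Y ^ q" using c1(1) u XY by simp
      also note lo
      also have "X ^ p \<le> M' ^ p" using XM XY by (intro power_mono) auto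
      finally have ul': "u \<le> l'" unfolding l'_def using c1(1) by (simp add: pos_le_divide_eq mult.commute)
      have R: "cmod (poly R (f z)) \<le> cR * M' ^ degree R" and T: "cmod (poly T (f z)) \<le> cT * M' ^ degree T"
        using cR(2)[of "f z"] cT(2)[of "f z"] power_mono[OF XM, of "degree R"] power_mono[OF XM, of "degree T"] XY cR(1) cT(1)
        by (auto simp flip: X_def elim!: order_trans)
      have a: "cmod (poly a (g z)) \<le> ca * N' ^ degree a" and b: "cmod (poly b (g z)) \<le> cb * N' ^ degree b"
        using ca(2)[of "g z"] cb(2)[of "g z"] power_mono[OF YN, of "degree a"] power_mono[OF YN, of "degree b"] XY ca(1) cb(1)
        by (auto simp flip: Y_def elim!: order_trans)
      have "cmod (V z) \<le> cmod (poly a (g z)) * cmod (poly R (f z)) * cmod (deriv g z) +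
          cmod (poly b (g z)) * (u ^ k / u\<^sup>2) * cmod (poly T (f z)) * cmod (deriv f z)"
        unfolding V u_def by (rule norm_triangle_le) (simp add: norm_mult norm_divide norm_power)
      also have "\<dots> \<le> ca * N' ^ degree a * (cR * M' ^ degree R) * cmod (deriv g z) +
          cb * N' ^ degree b * (l' ^ k / l ^ 2) * (cT * M' ^ degree T) * cmod (deriv f z)"
        using a b R T ul ul' u pos ca(1) cb(1) cR(1) cT(1)
        by (intro add_mono mult_mono frac_le power_mono order_refl) auto
      also have "\<dots> \<le> c * cmod (deriv g z) + c * cmod (deriv f z)"
        unfolding c_def using pos(1-4) ca(1) cb(1) cR(1) cT(1)
        by (intro add_mono mult_right_mono) (auto intro!: mult_nonneg_nonneg)
      finally have "cmod (V z) \<le> c * (cmod (deriv f z) + cmod (deriv g z))" by (simp add: algebra_simps)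
      from growth_weight_bound_compact[OF XY(1) XM XY(2) YN pos(3) ul norm_ge_zero norm_ge_zero pos(5) _ s0 this]
      have "cmod (V z) * u powr s * X powr (2 * \<epsilon>) * Y powr (2 * \<epsilon>) \<le> K3 * ?rhs z"
        unfolding K3_def X_def Y_def using \<epsilon>(1) by simp
      also have "\<dots> \<le> K * ?rhs z" using K rhs unfolding K_def by (intro mult_right_mono) auto
      finally show ?thesis .
    qed
    then show ?thesis by (simp add: X_def Y_def u_def)
  qed
  \<comment> \<open>As s is real, |exp (s h)| is |exp h| to the power s, so W realizes the factor in
    \<open>main\<close> by an entire function.\<close>
  define W where "W = (\<lambda>z. V z * exp (of_real s * h z))"
  have "W z = 0"
  \<comment> \<open>Replacing 1 + x by 2 x in both weights gives a factor 4, thus 16 after squaring;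
    the square of a sum of two terms gives another 2.\<close>
  proof (rule ahlfors_schwarz[where W = W and f = f and g = g and \<epsilon> = \<epsilon> and K = "32 * K\<^sup>2"])
    show "W holomorphic_on UNIV" unfolding W_def by (intro holomorphic_intros hol)
    fix z
    define X Y where "X = wt (f z)" and "Y = wt (g z)"
    have XY: "X \<ge> 1" "Y \<ge> 1" by (simp_all add: X_def Y_def wt_ge_1)
    have one: "1 \<le> X powr (2 * \<epsilon>)" "1 \<le> Y powr (2 * \<epsilon>)" using XY \<epsilon> by (simp_all add: ge_one_powr_ge_zero)
    have W: "cmod (W z) = cmod (V z) * cmod (exp (h z)) powr s"
      by (simp add: W_def norm_mult powr_def)
    let ?A = "cmod (deriv f z) * X powr (- 1 - \<epsilon>)" and ?B = "cmod (deriv g z) * Y powr (- 1 - \<epsilon>)"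
    have "cmod (W z) * (1 + X powr (2 * \<epsilon>)) * (1 + Y powr (2 * \<epsilon>)) \<le>
        cmod (W z) * (2 * X powr (2 * \<epsilon>)) * (2 * Y powr (2 * \<epsilon>))"
      using one by (intro mult_mono) auto
    also have "\<dots> \<le> 4 * (K * (?A + ?B))" using main[of z] unfolding W X_def Y_def by simp
    finally have "(cmod (W z) * (1 + X powr (2 * \<epsilon>)) * (1 + Y powr (2 * \<epsilon>)))\<^sup>2 \<le> (4 * (K * (?A + ?B)))\<^sup>2"
      by (intro power_mono) (auto intro!: mult_nonneg_nonneg add_nonneg_nonneg)
    also have "\<dots> = 16 * K\<^sup>2 * (?A + ?B)\<^sup>2" by (simp add: power_mult_distrib)
    also have "\<dots> \<le> 16 * K\<^sup>2 * (2 * (?A\<^sup>2 + ?B\<^sup>2))"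
      using sum_squares_bound[of ?A ?B] by (intro mult_left_mono) (auto simp: power2_sum)
    also have "?A\<^sup>2 = (cmod (deriv f z))\<^sup>2 * X powr (2 * (- 1 - \<epsilon>))"
      by (simp add: power_mult_distrib power2_eq_square flip: powr_add)
    also have "?B\<^sup>2 = (cmod (deriv g z))\<^sup>2 * Y powr (2 * (- 1 - \<epsilon>))"
      by (simp add: power_mult_distrib power2_eq_square flip: powr_add)
    finally show "(cmod (W z) * (1 + (1 + (cmod (f z))\<^sup>2) powr \<epsilon>) * (1 + (1 + (cmod (g z))\<^sup>2) powr \<epsilon>))\<^sup>2
      \<le> 32 * K\<^sup>2 * ((cmod (deriv f z))\<^sup>2 * (1 + (cmod (f z))\<^sup>2) powr (- 1 - \<epsilon>) +
         (cmod (deriv g z))\<^sup>2 * (1 + (cmod (g z))\<^sup>2) powr (- 1 - \<epsilon>))"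
      unfolding wt_powr X_def Y_def by (simp add: algebra_simps)
  qed (use hol \<epsilon> in auto)
  then show ?thesis by (simp add: W_def)
qed

section \<open>Rational functions of entire functions\<close>

text \<open>By the identity theorem: u vanishes on the nonempty open set where v does not.\<close>

lemma holomorphic_mult_eq_0:
  fixes u v :: "complex \<Rightarrow> complex"
  assumes "u holomorphic_on UNIV" "v holomorphic_on UNIV" and uv: "\<And>z. u z * v z = 0"
    and v: "v x \<noteq> 0"
  shows "u z = 0"
proof -
  have "open {z. v z \<noteq> 0}"
    using assms(2) by (intro open_Collect_neq holomorphic_on_imp_continuous_on continuous_on_const)
  then show ?thesis
    by (rule analytic_continuation_open[of _ UNIV u "\<lambda>_. 0"])
      (use assms in \<open>auto intro!: holomorphic_intros connected_UNIV\<close>)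
qed

lemma holomorphic_poly_compose:
  fixes f :: "complex \<Rightarrow> complex"
  shows "f holomorphic_on S \<Longrightarrow> (\<lambda>z. poly P (f z)) holomorphic_on S"
  by (induction P) (auto intro!: holomorphic_intros)

text \<open>Otherwise g would map the connected plane continuously into the finite set of roots of
  Q.\<close>

lemma entire_poly_compose_nonzero:
  fixes g :: "complex \<Rightarrow> complex"
  assumes "g holomorphic_on UNIV" "\<not> g constant_on UNIV" "Q \<noteq> 0"
  obtains z where "poly Q (g z) \<noteq> 0"
proof -
  have "\<exists>z. poly Q (g z) \<noteq> 0"
  proof (rule ccontr)
    assume "\<not> ?thesis"
    then have "range g \<subseteq> {x. poly Q x = 0}" by auto
    then have "finite (range g)" using poly_roots_finite[OF assms(3)] finite_subset by blast
    then have "g constant_on UNIV"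
      using continuous_finite_range_constant[OF connected_UNIV] holomorphic_on_imp_continuous_on assms(1) by blast
    with assms(2) show False by simp
  qed
  with that show ?thesis by blast
qed

lemma coprime_pair_growth:
  fixes A B :: "complex poly"
  assumes "coprime A B"
  obtains c c' where "c > 0" "c' > 0"
    "\<And>x. c * wt x ^ max (degree A) (degree B) \<le> cmod (poly A x) + cmod (poly B x)"
    "\<And>x. cmod (poly A x) + cmod (poly B x) \<le> c' * wt x ^ max (degree A) (degree B)"
proof -
  let ?m = "max (degree A) (degree B)"
  obtain c where c: "c > 0" "\<And>x. c * wt x ^ ?m \<le> cmod (poly A x) + cmod (poly B x)"
    using coprime_pair_ge_wt[OF assms] by blast
  obtain a where a: "a > 0" "\<And>x. cmod (poly A x) \<le> a * wt x ^ ?m"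
    using poly_le_wt[of A ?m] by auto
  obtain b where b: "b > 0" "\<And>x. cmod (poly B x) \<le> b * wt x ^ ?m"
    using poly_le_wt[of B ?m] by auto
  have ab: "cmod (poly A x) + cmod (poly B x) \<le> (a + b) * wt x ^ ?m" for x
    using add_mono[OF a(2)[of x] b(2)[of x]] by (simp only: distrib_right)
  show ?thesis by (rule that[OF c(1) _ c(2) ab]) (use a(1) b(1) in auto)
qed

text \<open>\<open>rf_zero\<close> looks at the reduced fraction, so the cancelled factor e has to
  be controlled. If B had order m > 0 at x, then e would have order 2 m there, as the reduced
  denominator is nonzero at x; but e divides A' B - A B', whose order at x is only m - 1.\<close>

lemma rf_deriv_zero:
  assumes "rf_zero (rf_deriv F) x"
  shows "poly (pderiv (rf_num F) * rf_den F - rf_num F * pderiv (rf_den F)) x = 0"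
    and "poly (rf_den F) x \<noteq> 0"
proof -
  define A B where "A = rf_num F" and "B = rf_den F"
  have cop: "coprime A B" and B: "B \<noteq> 0"
    unfolding A_def B_def rf_num_def rf_den_def by (simp_all add: coprime_quot_of_fract)
  define N where "N = pderiv A * B - A * pderiv B"
  define N' M' where "N' = rf_num (rf_deriv F)" and "M' = rf_den (rf_deriv F)"
  have cop': "coprime N' M'" and M': "M' \<noteq> 0"
    unfolding N'_def M'_def rf_num_def rf_den_def by (simp_all add: coprime_quot_of_fract)
  have "B ^ 2 \<noteq> 0" using B by simp
  moreover have "quot_of_fract (rf_deriv F) = normalize_quot (N, B ^ 2)"
    using quot_of_fract_quot_to_fract[of "(N, B ^ 2)"] \<open>B ^ 2 \<noteq> 0\<close>
    by (simp add: quot_to_fract_def rf_deriv_def N_def A_def B_def)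
  ultimately obtain e where e: "N = N' * e" "B ^ 2 = M' * e"
    unfolding N'_def M'_def rf_num_def rf_den_def by (metis normalize_quotE)
  have N'x: "poly N' x = 0" using assms by (simp add: rf_zero_def N'_def)
  then have M'x: "poly M' x \<noteq> 0" using coprime_poly_0[OF cop', of x] by simp
  show "poly (pderiv (rf_num F) * rf_den F - rf_num F * pderiv (rf_den F)) x = 0"
    using N'x e(1) unfolding N_def A_def B_def by simp
  show "poly (rf_den F) x \<noteq> 0"
  proof
    assume "poly (rf_den F) x = 0"
    then have Bx: "poly B x = 0" by (simp add: B_def)
    define m where "m = order x B"
    have "order x (B ^ 2) = 2 * m" using B by (simp add: power2_eq_square order_mult m_def)
    moreover have "order x (M' * e) = order x e"
      using M'x e(2) \<open>B ^ 2 \<noteq> 0\<close> by (subst order_mult) (auto simp: order_0I)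
    ultimately have "order x e = 2 * m" using e(2) by simp
    then have "[:- x, 1:] ^ m dvd e" by (simp add: order_divides)
    then have "[:- x, 1:] ^ m dvd N" by (simp add: e(1))
    moreover have "[:- x, 1:] ^ m dvd B" by (simp add: order_divides m_def)
    ultimately have "[:- x, 1:] ^ m dvd pderiv A * B - N" by (simp add: dvd_diff)
    then have "[:- x, 1:] ^ m dvd A * pderiv B" by (simp add: N_def)
    moreover have Ax: "poly A x \<noteq> 0" using coprime_poly_0[OF cop, of x] Bx by simp
    moreover have B': "pderiv B \<noteq> 0"
    proof
      assume "pderiv B = 0"
      then obtain b where "B = [:b:]" using pderiv_iszero by blast
      with Bx B show False by simp
    qed
    ultimately have "m \<le> order x (A * pderiv B)" by (auto simp: order_divides)
    also have "\<dots> = order x (pderiv B)"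
      using Ax B' by (subst order_mult) (auto simp: order_0I)
    finally show False using order_pderiv[OF B Bx] by (simp add: m_def)
  qed
qed

lemma deriv_poly_compose:
  fixes f :: "complex \<Rightarrow> complex"
  assumes "f holomorphic_on UNIV"
  shows "((\<lambda>z. poly P (f z)) has_field_derivative poly (pderiv P) (f z) * deriv f z) (at z)"
  using assms holomorphic_derivI[of f UNIV z UNIV] by (intro DERIV_chain2[OF poly_DERIV]) auto

text \<open>A common factor of a pair multiplies its Wronskian by the square of that factor, because
  the terms with h' cancel.\<close>

lemma wronskian_transform:
  fixes f g h :: "complex \<Rightarrow> complex" and A B C D :: "complex poly"
  assumes hol: "f holomorphic_on UNIV" "g holomorphic_on UNIV" "h holomorphic_on UNIV"
    and A: "\<And>z. poly A (f z) = exp (h z) * poly C (g z)"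
    and B: "\<And>z. poly B (f z) = exp (h z) * poly D (g z)"
  shows "poly (pderiv A * B - A * pderiv B) (f z) * deriv f z =
    exp (h z) ^ 2 * (poly (pderiv C * D - C * pderiv D) (g z) * deriv g z)"
proof -
  have eq: "poly (pderiv P) (f z) * deriv f z =
      exp (h z) * deriv h z * poly Q (g z) + exp (h z) * (poly (pderiv Q) (g z) * deriv g z)"
    if PQ: "\<And>z. poly P (f z) = exp (h z) * poly Q (g z)" for P Q
  proof -
    have h: "(h has_field_derivative deriv h z) (at z)"
      using hol(3) holomorphic_derivI[of h UNIV z UNIV] by simp
    have "((\<lambda>z. exp (h z) * poly Q (g z)) has_field_derivative
        exp (h z) * deriv h z * poly Q (g z) + exp (h z) * (poly (pderiv Q) (g z) * deriv g z)) (at z)"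
      by (rule DERIV_cong[OF DERIV_mult[OF DERIV_fun_exp[OF h] deriv_poly_compose[OF hol(2)]]])
        (simp add: mult_ac)
    then have "((\<lambda>z. poly P (f z)) has_field_derivative
        exp (h z) * deriv h z * poly Q (g z) + exp (h z) * (poly (pderiv Q) (g z) * deriv g z)) (at z)"
      unfolding PQ .
    then show ?thesis using DERIV_unique deriv_poly_compose[OF hol(1)] by blast
  qed
  have "poly (pderiv A * B - A * pderiv B) (f z) * deriv f z =
     (poly (pderiv A) (f z) * deriv f z) * poly B (f z) - poly A (f z) * (poly (pderiv B) (f z) * deriv f z)"
    by (simp add: algebra_simps)
  also have "\<dots> = exp (h z) ^ 2 * (poly (pderiv C * D - C * pderiv D) (g z) * deriv g z)"
    unfolding eq[OF A] eq[OF B] A B by (simp add: algebra_simps power2_eq_square)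
  finally show ?thesis .
qed

text \<open>The factor is built from Bezout coefficients of C and D instead of as A(f) / C(g), whose
  denominator may vanish. A zero of it would be a common zero of A(f) and B(f), so it is zero-free
  and has an entire logarithm.\<close>

lemma rf_comp_eq_unit:
  assumes hol: "f holomorphic_on UNIV" "g holomorphic_on UNIV" and eq: "rf_comp_eq F f G g"
  obtains h where "h holomorphic_on UNIV"
    "\<And>z. poly (rf_num F) (f z) = exp (h z) * poly (rf_num G) (g z)"
    "\<And>z. poly (rf_den F) (f z) = exp (h z) * poly (rf_den G) (g z)"
proof -
  define A B C D where "A = rf_num F" and "B = rf_den F" and "C = rf_num G" and "D = rf_den G"
  have cop: "coprime A B" "coprime C D"
    unfolding A_def B_def C_def D_def rf_num_def rf_den_def by (simp_all add: coprime_quot_of_fract)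
  note [holomorphic_intros] = holomorphic_poly_compose[OF hol(1)] holomorphic_poly_compose[OF hol(2)]
  obtain z1 z2 where z: "poly B (f z1) \<noteq> 0" "poly D (g z2) \<noteq> 0"
    using eq unfolding rf_comp_eq_def rf_pole_def B_def D_def by blast
  \<comment> \<open>At poles of either side the last two factors vanish, so this product is zero
    everywhere; those factors are not identically zero and are cancelled one at a time.\<close>
  have 0: "(poly A (f z) * poly D (g z) - poly B (f z) * poly C (g z)) * poly B (f z) * poly D (g z) = 0" for z
  proof (cases "poly B (f z) = 0 \<or> poly D (g z) = 0")
    case False
    then have "poly A (f z) / poly B (f z) = poly C (g z) / poly D (g z)"
      using eq unfolding rf_comp_eq_def rf_pole_def rf_eval_def A_def B_def C_def D_def by blast
    with False show ?thesis by (simp add: field_simps)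
  qed auto
  have "(poly A (f z) * poly D (g z) - poly B (f z) * poly C (g z)) * poly B (f z) = 0" for z
    by (rule holomorphic_mult_eq_0[of _ "\<lambda>z. poly D (g z)"], (intro holomorphic_intros)+, rule 0, rule z(2))
  then have "poly A (f z) * poly D (g z) - poly B (f z) * poly C (g z) = 0" for z
    by (intro holomorphic_mult_eq_0[of "\<lambda>z. poly A (f z) * poly D (g z) - poly B (f z) * poly C (g z)" "\<lambda>z. poly B (f z)"])
      (intro holomorphic_intros, intro holomorphic_intros, blast, rule z(1))
  then have cross: "poly A (f z) * poly D (g z) = poly B (f z) * poly C (g z)" for z by simp
  obtain a b where ab: "a * C + b * D = 1" using complex_poly_bezout[OF cop(2)] by blast
  have ab': "poly a x * poly C x + poly b x * poly D x = 1" for x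
    using arg_cong[OF ab, of "\<lambda>p. poly p x"] by simp
  define U where "U = (\<lambda>z. poly a (g z) * poly A (f z) + poly b (g z) * poly B (f z))"
  have AU: "poly A (f z) = U z * poly C (g z)" for z
  proof -
    have "U z * poly C (g z) = poly a (g z) * poly C (g z) * poly A (f z) + poly b (g z) * (poly B (f z) * poly C (g z))"
      by (simp add: U_def algebra_simps)
    also have "\<dots> = poly A (f z) * (poly a (g z) * poly C (g z) + poly b (g z) * poly D (g z))"
      unfolding cross[symmetric] by (simp add: algebra_simps)
    finally show ?thesis unfolding ab' by simp
  qed
  have BU: "poly B (f z) = U z * poly D (g z)" for z
  proof -
    have "U z * poly D (g z) = poly a (g z) * (poly A (f z) * poly D (g z)) + poly b (g z) * poly D (g z) * poly B (f z)"
      by (simp add: U_def algebra_simps)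
    also have "\<dots> = poly B (f z) * (poly a (g z) * poly C (g z) + poly b (g z) * poly D (g z))"
      unfolding cross by (simp add: algebra_simps)
    finally show ?thesis unfolding ab' by simp
  qed
  have "U z \<noteq> 0" for z using AU[of z] BU[of z] coprime_poly_0[OF cop(1), of "f z"] by auto
  moreover have "U holomorphic_on UNIV" unfolding U_def by (intro holomorphic_intros)
  ultimately obtain h where h: "h holomorphic_on UNIV" "\<And>z. exp (h z) = U z"
    using holomorphic_logarithm_exists[of UNIV U 0] by auto
  show ?thesis using that[OF h(1)] AU BU unfolding h(2) A_def B_def C_def D_def by blast
qed

text \<open>\<open>zero_value\<close> and \<open>nonconst\<close> exclude the situations of
  \<open>zero_value_counterexample\<close> and \<open>constant_counterexample\<close>. The former
  keeps the degree of C - F(c j) D equal to q when deg C < deg D; the latter ensures that a nonzero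
  polynomial in g is not identically zero.\<close>

theorem theorem1:
  fixes F G :: ratfun and k :: nat and c :: "nat \<Rightarrow> complex"
    and f g :: "complex \<Rightarrow> complex"
  assumes M: "condition_M F G k c"
    and zero_value: "\<forall>j\<in>{1..k}. degree (rf_num G) < degree (rf_den G) \<longrightarrow> rf_eval F (c j) \<noteq> 0"
    and f: "f holomorphic_on UNIV" and g: "g holomorphic_on UNIV"
    and nonconst: "\<not> g constant_on UNIV"
    and eq: "rf_comp_eq F f G g"
  shows "k * rf_degree G \<le> rf_degree F"
proof (rule ccontr)
  define A B C D where "A = rf_num F" and "B = rf_den F" and "C = rf_num G" and "D = rf_den G"
  define p q where "p = rf_degree F" and "q = rf_degree G"
  define w where "w = (\<lambda>j. rf_eval F (c j))"
  define J where "J = {1..k}"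
  have p_def': "p = max (degree A) (degree B)" and q_def': "q = max (degree C) (degree D)"
    by (simp_all add: p_def q_def rf_degree_def A_def B_def C_def D_def)
  assume "\<not> k * rf_degree G \<le> rf_degree F"
  then have pkq: "p < k * q" by (simp add: p_def q_def)
  then have k: "k > 0" and q: "q > 0" by (auto intro!: gr0I)
  have cop: "coprime A B" "coprime C D"
    unfolding A_def B_def C_def D_def rf_num_def rf_den_def by (simp_all add: coprime_quot_of_fract)
  have lc: "lead_coeff C = 1" "lead_coeff D = 1"
    and w_inj: "\<And>i j. i \<in> J \<Longrightarrow> j \<in> J \<Longrightarrow> i \<noteq> j \<Longrightarrow> w i \<noteq> w j"
    and w1: "\<And>j. j \<in> J \<Longrightarrow> degree C = degree D \<Longrightarrow> w j \<noteq> 1"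
    and w0: "\<And>j. j \<in> J \<Longrightarrow> degree C < degree D \<Longrightarrow> w j \<noteq> 0"
    and crit: "\<And>j. j \<in> J \<Longrightarrow> rf_zero (rf_deriv F) (c j)"
    and reg: "\<And>j d. j \<in> J \<Longrightarrow> poly (pderiv C - smult (w j) (pderiv D)) d = 0 \<Longrightarrow>
      poly C d / poly D d \<noteq> w j \<and> poly D d \<noteq> 0"
    using M zero_value unfolding condition_M_def Let_def w_def J_def C_def D_def rf_eval_def[of G] by blast+
  define P Q where "P = (\<lambda>j. A - smult (w j) B)" and "Q = (\<lambda>j. C - smult (w j) D)"
  define Wf Wg where "Wf = pderiv A * B - A * pderiv B" and "Wg = pderiv C * D - C * pderiv D"
  obtain h where h: "h holomorphic_on UNIV" and Ah: "\<And>z. poly A (f z) = exp (h z) * poly C (g z)"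
    and Bh: "\<And>z. poly B (f z) = exp (h z) * poly D (g z)"
    using rf_comp_eq_unit[OF f g eq] unfolding A_def B_def C_def D_def by blast
  have PQ: "poly (P j) (f z) = exp (h z) * poly (Q j) (g z)" for j z
    by (simp add: P_def Q_def Ah Bh algebra_simps)
  \<comment> \<open>Leading terms can cancel only if deg C = deg D, where condition 3 prevents it
    for monic C and D; if D has the larger degree, \<open>zero_value\<close> keeps its leading
    term.\<close>
  have degQ: "degree (Q j) = q" if j: "j \<in> J" for j
  proof -
    consider "degree C > degree D" | "degree C = degree D" | "degree C < degree D" by linarith
    then show ?thesis
    proof cases
      case 1
      then show ?thesis unfolding Q_def q_def'
        using degree_add_eq_left[of "- smult (w j) D" C] by simp
    next
      case 2
      have "coeff (Q j) (degree C) = 1 - w j" using lc 2 by (simp add: Q_def)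
      then have "degree C \<le> degree (Q j)" using w1[OF j 2] by (intro le_degree) simp
      moreover have "degree (Q j) \<le> degree C" unfolding Q_def using 2 by (intro degree_diff_le) auto
      ultimately show ?thesis using 2 by (simp add: q_def')
    next
      case 3
      then show ?thesis unfolding Q_def q_def'
        using w0[OF j 3] degree_add_eq_right[of C "- smult (w j) D"] by simp
    qed
  qed
  then have Q0: "Q j \<noteq> 0" if "j \<in> J" for j using q that by fastforce
  have P0: "P j \<noteq> 0" if "j \<in> J" for j
  proof
    assume "P j = 0"
    obtain z where "poly (Q j) (g z) \<noteq> 0"
      using entire_poly_compose_nonzero[OF g nonconst Q0[OF \<open>j \<in> J\<close>]] .
    with PQ[of j z] \<open>P j = 0\<close> show False by simp
  qed
  have degP: "degree (P j) \<le> p" for j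
    unfolding P_def p_def' by (rule degree_diff_le) auto
  \<comment> \<open>Condition 4 enters here. At a root of \<open>Q j\<close> the Wronskian
    \<open>Wg\<close> equals (C' - w D') D, so coprimality to \<open>Wg\<close> says that
    \<open>Q j\<close> has no multiple root, with one polynomial \<open>Wg\<close> serving all
    j.\<close>
  have copQ: "coprime (Q j) Wg" if j: "j \<in> J" for j
  proof (rule coprime_complex_polyI)
    fix x assume x: "poly (Q j) x = 0"
    then have Cx: "poly C x = w j * poly D x" by (simp add: Q_def)
    then have D: "poly D x \<noteq> 0" using coprime_poly_0[OF cop(2), of x] by auto
    then have "poly (pderiv C - smult (w j) (pderiv D)) x \<noteq> 0"
      using reg[OF j, of x] Cx by auto
    moreover have "poly Wg x = poly (pderiv C - smult (w j) (pderiv D)) x * poly D x"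
      using Cx by (simp add: Wg_def algebra_simps)
    ultimately show "poly Wg x \<noteq> 0" using D by simp
  qed
  have copP: "coprime (P i) (P j)" if ij: "i \<in> J" "j \<in> J" "i \<noteq> j" for i j
  proof (rule coprime_complex_polyI)
    fix x assume "poly (P i) x = 0"
    then have i: "poly A x = w i * poly B x" by (simp add: P_def)
    then have "poly B x \<noteq> 0" using coprime_poly_0[OF cop(1), of x] by auto
    then show "poly (P j) x \<noteq> 0" using i w_inj[OF ij] by (simp add: P_def)
  qed
  \<comment> \<open>Since \<open>Wf\<close> = (P j)' B - (P j) B', it is congruent to (P j)' B
    modulo \<open>P j\<close>. Hence a zero of F' is a multiple root of \<open>P j\<close>, and the
    divisibility from \<open>radical_divisor\<close> passes to \<open>Wf\<close>, which is
    independent of j.\<close>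
  have "\<exists>R. R dvd P j \<and> degree R + 1 \<le> degree (P j) \<and> P j dvd R * Wf" if j: "j \<in> J" for j
  proof -
    let ?c = "c j"
    have B: "poly B ?c \<noteq> 0" and W: "poly Wf ?c = 0"
      using rf_deriv_zero[OF crit[OF j]] by (simp_all add: A_def B_def Wf_def)
    have w: "w j * poly B ?c = poly A ?c"
      using B by (simp add: w_def rf_eval_def A_def B_def)
    then have "poly (P j) ?c = 0" by (simp add: P_def)
    moreover have "poly (pderiv (P j)) ?c * poly B ?c = 0"
    proof -
      have "poly (pderiv (P j)) ?c * poly B ?c =
        poly (pderiv A) ?c * poly B ?c - (w j * poly B ?c) * poly (pderiv B) ?c"
        by (simp add: P_def pderiv_diff pderiv_smult algebra_simps)
      also have "\<dots> = poly Wf ?c" unfolding w by (simp add: Wf_def)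
      finally show ?thesis using W by simp
    qed
    ultimately obtain R where R: "R dvd P j" "degree R + 1 \<le> degree (P j)" "P j dvd R * pderiv (P j)"
      using radical_divisor[OF P0[OF j], of ?c] B by auto
    have "R * Wf = R * pderiv (P j) * B - R * P j * pderiv B"
      by (simp add: Wf_def P_def pderiv_diff pderiv_smult algebra_simps)
    moreover have "P j dvd R * pderiv (P j) * B - R * P j * pderiv B"
      using R(3) by (intro dvd_diff) auto
    ultimately show ?thesis using R by auto
  qed
  then obtain R where R: "\<And>j. j \<in> J \<Longrightarrow> R j dvd P j" "\<And>j. j \<in> J \<Longrightarrow> degree (R j) + 1 \<le> degree (P j)"
    "\<And>j. j \<in> J \<Longrightarrow> P j dvd R j * Wf" by metis
  have R0: "R j \<noteq> 0" if "j \<in> J" for j using R(1)[OF that] P0[OF that] by auto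
  define PP EE RR where "PP = (\<Prod>j\<in>J. P j)" and "EE = (\<Prod>j\<in>J. Q j)" and "RR = (\<Prod>j\<in>J. R j)"
  have finJ: "finite J" "card J = k" by (simp_all add: J_def)
  \<comment> \<open>The values F(c j) are distinct, so the \<open>P j\<close> are pairwise coprime
    and a single factor \<open>Wf\<close> suffices for their whole product.\<close>
  have "PP dvd RR * Wf"
    unfolding PP_def
  proof (rule prod_dvd_of_pairwise_coprime[OF finJ(1) copP])
    fix j assume j: "j \<in> J"
    have "R j dvd RR" unfolding RR_def using finJ j by (intro dvd_prodI)
    then show "P j dvd RR * Wf" using R(3)[OF j] by (meson dvd_refl dvd_trans mult_dvd_mono)
  qed
  then obtain T where T: "RR * Wf = PP * T" by (elim dvdE)
  have "coprime EE Wg" unfolding EE_def by (rule prod_coprime_left[OF copQ])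
  then obtain a b where "a * EE + b * Wg = 1" using complex_poly_bezout by blast
  then have ab: "poly a x * poly EE x + poly b x * poly Wg x = 1" for x
    by (metis poly_1 poly_add poly_mult)
  have PE: "poly PP (f z) = exp (h z) ^ k * poly EE (g z)" for z
    by (simp add: PP_def EE_def poly_prod PQ prod.distrib finJ)
  \<comment> \<open>\<open>V\<close> is \<open>RR (f) g' / EE (g)\<close> with the pole removed: multiply by \<open>1 = a EE + b Wg\<close> and
    rewrite \<open>Wg (g) g'\<close> as \<open>Wf (f) f' / exp (2 h)\<close>.\<close>
  define V where "V = (\<lambda>z. poly a (g z) * poly RR (f z) * deriv g z +
      poly b (g z) * (exp (h z) ^ k / exp (h z) ^ 2) * poly T (f z) * deriv f z)"
  have EV: "poly EE (g z) * V z = poly RR (f z) * deriv g z" for z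
  proof -
    define u where "u = exp (h z)"
    have u: "u \<noteq> 0" by (simp add: u_def)
    have RT: "poly RR (f z) * poly Wf (f z) = u ^ k * poly EE (g z) * poly T (f z)"
      using arg_cong[OF T, of "\<lambda>p. poly p (f z)"] by (simp add: PE u_def)
    have W: "poly Wf (f z) * deriv f z = u ^ 2 * (poly Wg (g z) * deriv g z)"
      unfolding Wf_def Wg_def u_def by (rule wronskian_transform[OF f g h Ah Bh])
    have "poly EE (g z) * V z = poly a (g z) * poly EE (g z) * (poly RR (f z) * deriv g z) +
        poly b (g z) * (u ^ k * poly EE (g z) * poly T (f z)) * deriv f z / u ^ 2"
      by (simp add: V_def u_def algebra_simps)
    also have "poly b (g z) * (u ^ k * poly EE (g z) * poly T (f z)) * deriv f z / u ^ 2 =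
        poly b (g z) * poly RR (f z) * (poly Wf (f z) * deriv f z) / u ^ 2"
      unfolding RT[symmetric] by simp
    also have "\<dots> = poly b (g z) * poly Wg (g z) * (poly RR (f z) * deriv g z)"
      unfolding W using u by simp
    also have "poly a (g z) * poly EE (g z) * (poly RR (f z) * deriv g z) + \<dots> =
        (poly a (g z) * poly EE (g z) + poly b (g z) * poly Wg (g z)) * (poly RR (f z) * deriv g z)"
      by (simp add: algebra_simps)
    finally show ?thesis unfolding ab by simp
  qed
  have degE: "degree EE = k * q"
    unfolding EE_def using Q0 finJ degQ by (subst degree_prod_sum_eq) auto
  have degPP: "degree PP = (\<Sum>j\<in>J. degree (P j))"
    unfolding PP_def using P0 by (rule degree_prod_sum_eq)
  have degRR: "degree RR + k \<le> degree PP"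
  proof -
    have "degree RR + k = (\<Sum>j\<in>J. degree (R j) + 1)"
      unfolding RR_def sum.distrib using R0 finJ by (subst degree_prod_sum_eq) auto
    also have "\<dots> \<le> degree PP" unfolding degPP by (rule sum_mono[OF R(2)])
    finally show ?thesis .
  qed
  have degPP': "degree PP \<le> k * p"
    unfolding degPP using sum_bounded_above[of J "\<lambda>j. degree (P j)" p] degP finJ by simp
  have PP0: "PP \<noteq> 0" and EE0: "EE \<noteq> 0" using P0 Q0 finJ by (simp_all add: PP_def EE_def)
  have p: "p > 0"
    using R(2)[of 1] degP[of 1] k by (simp add: J_def)
  obtain cA cA' where cA: "cA > 0" "cA' > 0" "\<And>x. cA * wt x ^ p \<le> cmod (poly A x) + cmod (poly B x)"
    "\<And>x. cmod (poly A x) + cmod (poly B x) \<le> cA' * wt x ^ p"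
    using coprime_pair_growth[OF cop(1)] unfolding p_def' by blast
  obtain cC cC' where cC: "cC > 0" "cC' > 0" "\<And>x. cC * wt x ^ q \<le> cmod (poly C x) + cmod (poly D x)"
    "\<And>x. cmod (poly C x) + cmod (poly D x) \<le> cC' * wt x ^ q"
    using coprime_pair_growth[OF cop(2)] unfolding q_def' by blast
  \<comment> \<open>Both members of the pair carry the same factor exp h, so the sums of moduli do
    too; the two-sided growth bounds for coprime pairs then give \<open>lower\<close> and
    \<open>upper\<close>.\<close>
  have AC: "cmod (poly A (f z)) + cmod (poly B (f z)) =
      cmod (exp (h z)) * (cmod (poly C (g z)) + cmod (poly D (g z)))" for z
    unfolding Ah Bh norm_mult by (simp only: distrib_left)
  have lower: "cC / cA' * cmod (exp (h z)) * wt (g z) ^ q \<le> wt (f z) ^ p" for z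
  proof -
    have "cmod (exp (h z)) * (cC * wt (g z) ^ q) \<le> cA' * wt (f z) ^ p"
      using order_trans[OF mult_left_mono[OF cC(3) norm_ge_zero] cA(4)[of "f z", unfolded AC]] .
    then show ?thesis using cA(2) by (simp add: pos_divide_le_eq mult_ac)
  qed
  have upper: "wt (f z) ^ p \<le> cC' / cA * cmod (exp (h z)) * wt (g z) ^ q" for z
  proof -
    have "cA * wt (f z) ^ p \<le> cmod (exp (h z)) * (cC' * wt (g z) ^ q)"
      using order_trans[OF cA(3)[of "f z", unfolded AC] mult_left_mono[OF cC(4) norm_ge_zero]] .
    then show ?thesis using cA(1) by (simp add: pos_le_divide_eq mult_ac)
  qed
  have "V holomorphic_on UNIV"
    unfolding V_def by (intro holomorphic_intros holomorphic_poly_compose f g h holomorphic_deriv) auto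
  moreover have "cC / cA' > 0" "cC' / cA > 0" using cA(1,2) cC(1,2) by simp_all
  ultimately have V0: "V z = 0" for z
    using V_def by (intro entire_form_vanishes[OF f g h _ p pkq _ lower _ upper PE EV _ degE degRR degPP' PP0 EE0]) auto
  have RR_dvd: "RR dvd PP" unfolding RR_def PP_def by (rule prod_dvd_prod[OF R(1)])
  \<comment> \<open>V = 0 leaves R(f) g' = 0. Where g' is nonzero, the zero of R(f) is one of P(f),
    hence of E(g); so E(g) g' vanishes identically and g would be constant.\<close>
  have 0: "poly EE (g z) * deriv g z = 0" for z
  proof (cases "deriv g z = 0")
    case False
    then have "poly RR (f z) = 0" using EV[of z] V0[of z] by simp
    then have "poly PP (f z) = 0" using RR_dvd by (auto elim!: dvdE)
    then show ?thesis using PE[of z] by simp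
  qed simp
  obtain x where x: "poly EE (g x) \<noteq> 0" using entire_poly_compose_nonzero[OF g nonconst EE0] .
  have "deriv g z = 0" for z
    by (rule holomorphic_mult_eq_0[of "deriv g" "\<lambda>z. poly EE (g z)", OF _ _ _ x])
      (use 0 in \<open>auto intro!: holomorphic_deriv holomorphic_poly_compose g simp: mult.commute\<close>)
  then have "g constant_on UNIV"
    using DERIV_zero_connected_constant_on[of UNIV "{}" g] holomorphic_derivI[OF g]
      holomorphic_on_imp_continuous_on[OF g] by auto
  with nonconst show False by simp
qed

end
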